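(* Let $r\in\{1,2,3,\dots\}\cup\{\infty\}$ and let $M,\widetilde M\subset\mathbb{R}^m$ be two embedded manifolds of class $C^r$, both of dimension $p$, with $x^0\in M\cap\widetilde M$ and $T_{x^0}M=T_{x^0}\widetilde M$. Let $$s:=\sup\{k\in\mathbb{N}: k\le r \text{ and } M,\widetilde M \text{ have at } x^0 \text{ the order of tangency at least } k\},$$ and assume that $s<r$. Then $$\min_{v}\Big(\max_{\gamma,\tilde\gamma}\big(\max\{\,l\in\{0\}\cup\mathbb{N} : |\gamma(t)-\tilde\gamma(t)|=o(|t|^l)\text{ when } t\to 0\,\}\big)\Big)=s .$$ Here the minimum is taken over all $0\neq v\in T_{x^0}M=T_{x^0}\widetilde M$, and the outer maximum is taken over all pairs of $C^r$ curves $\gamma\subset M$, $\tilde\gamma\subset\widetilde M$ (parametrized by $t$ near $0\in\mathbb{R}$) such that $\gamma(0)=x^0=\tilde\gamma(0)$ and the velocities $\dot\gamma(0)$, $\dot{\tilde\gamma}(0)$ are both non-zero and both parallel to $v$. A maximum over an unbounded set is read as $+\infty$.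
   Context: Order of tangency: let $M,\widetilde M\subset\mathbb{R}^m$ be embedded manifolds of class $C^r$, $r\ge 1$, of the same dimension $p$, with $x^0\in M\cap\widetilde M$, and let $k\le r$ be a (finite) non-negative integer. One says that $M$ and $\widetilde M$ have at $x^0$ the order of tangency at least $k$ if there exist a point $u^0\in\mathbb{R}^p$, a neighbourhood $U\ni u^0$ in $\mathbb{R}^p$, and $C^r$ parametrizations (diffeomorphisms onto their images, which are neighbourhoods of $x^0$ in $M$, respectively $\widetilde M$) $q:(U,u^0)\to(M,x^0)$ and $\tilde q:(U,u^0)\to(\widetilde M,x^0)$, with $q(u^0)=x^0=\tilde q(u^0)$, such that $$(\tilde q-q)(u)=o\big(|u-u^0|^k\big)\quad\text{when } U\ni u\to u^0 .$$ "Parallel to $v$" means being a scalar multiple of $v$ (either sign allowed). *)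

theory Defs
  imports "HOL-Analysis.Analysis" "HOL-Library.Landau_Symbols" "HOL-Library.Extended_Nat"
begin

primrec Ck_on :: "nat \<Rightarrow> ('a::euclidean_space \<Rightarrow> 'b::euclidean_space) \<Rightarrow> 'a set \<Rightarrow> bool" where
  "Ck_on 0 f S \<longleftrightarrow> continuous_on S f"
| "Ck_on (Suc k) f S \<longleftrightarrow>
     (\<forall>x\<in>S. f differentiable (at x)) \<and>
     (\<forall>v. Ck_on k (\<lambda>x. frechet_derivative f (at x) v) S)"

(* Meaningful for open S only, since the derivatives are taken at full neighbourhoods;
   r = \<infinity> gives the C-infinity maps. *)
definition Cr_on :: "enat \<Rightarrow> ('a::euclidean_space \<Rightarrow> 'b::euclidean_space) \<Rightarrow> 'a set \<Rightarrow> bool" where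
  "Cr_on r f S \<longleftrightarrow> (\<forall>k. enat k \<le> r \<longrightarrow> Ck_on k f S)"

(* On an arbitrary subset X of a Euclidean space, being of class C^r means having local
   C^r extensions to open sets of the ambient space (Milnor's convention). *)
definition Cr_on_subset ::
  "enat \<Rightarrow> ('a::euclidean_space \<Rightarrow> 'b::euclidean_space) \<Rightarrow> 'a set \<Rightarrow> bool" where
  "Cr_on_subset r f X \<longleftrightarrow>
     (\<forall>x\<in>X. \<exists>W F. open W \<and> x \<in> W \<and> Cr_on r F W \<and> (\<forall>y\<in>W \<inter> X. F y = f y))"

definition Cr_parametrization ::
  "enat \<Rightarrow> 'a::euclidean_space set \<Rightarrow> 'p::euclidean_space set \<Rightarrow> ('p \<Rightarrow> 'a) \<Rightarrow> bool" where
  "Cr_parametrization r M U q \<longleftrightarrow>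
     open U \<and> openin (top_of_set M) (q ` U) \<and> inj_on q U \<and>
     Cr_on r q U \<and> Cr_on_subset r (inv_into U q) (q ` U)"

(* The model space R^p, and with it the dimension p, is passed as a type. *)
definition Cr_manifold ::
  "'p::euclidean_space itself \<Rightarrow> enat \<Rightarrow> 'a::euclidean_space set \<Rightarrow> bool" where
  "Cr_manifold _ r M \<longleftrightarrow>
     (\<forall>x\<in>M. \<exists>(U :: 'p set) q. Cr_parametrization r M U q \<and> x \<in> q ` U)"

(* Curves are germs at 0: the values of g away from a neighbourhood of 0 are irrelevant. *)
definition Cr_curve ::
  "enat \<Rightarrow> 'a::euclidean_space set \<Rightarrow> 'a \<Rightarrow> (real \<Rightarrow> 'a) \<Rightarrow> bool" where
  "Cr_curve r M x g \<longleftrightarrow>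
     g 0 = x \<and> (\<exists>e>0. Cr_on r g {-e<..<e} \<and> g ` {-e<..<e} \<subseteq> M)"

abbreviation velocity :: "(real \<Rightarrow> 'a::euclidean_space) \<Rightarrow> 'a" where
  "velocity g \<equiv> vector_derivative g (at 0)"

definition tangent_space ::
  "enat \<Rightarrow> 'a::euclidean_space set \<Rightarrow> 'a \<Rightarrow> 'a set" where
  "tangent_space r M x = {velocity g | g. Cr_curve r M x g}"

definition tangency_at_least ::
  "'p::euclidean_space itself \<Rightarrow> enat \<Rightarrow>
   'a::euclidean_space set \<Rightarrow> 'a set \<Rightarrow> 'a \<Rightarrow> nat \<Rightarrow> bool" where
  "tangency_at_least _ r M M' x k \<longleftrightarrow>
     (\<exists>(u0 :: 'p) U q q'.
        u0 \<in> U \<and>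
        Cr_parametrization r M U q \<and> Cr_parametrization r M' U q' \<and>
        q u0 = x \<and> q' u0 = x \<and>
        (\<lambda>u. norm (q' u - q u)) \<in> o[at u0 within U](\<lambda>u. norm (u - u0) ^ k))"

definition parallel_to :: "'a::real_vector \<Rightarrow> 'a \<Rightarrow> bool" where
  "parallel_to w v \<longleftrightarrow> (\<exists>c. w = c *\<^sub>R v)"

definition curve_pairs ::
  "enat \<Rightarrow> 'a::euclidean_space set \<Rightarrow> 'a set \<Rightarrow> 'a \<Rightarrow> 'a \<Rightarrow>
   ((real \<Rightarrow> 'a) \<times> (real \<Rightarrow> 'a)) set" where
  "curve_pairs r M M' x v =
     {(g, g'). Cr_curve r M x g \<and> Cr_curve r M' x g' \<and>
        velocity g \<noteq> 0 \<and> velocity g' \<noteq> 0 \<and>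
        parallel_to (velocity g) v \<and> parallel_to (velocity g') v}"

(* On enat, Sup of a nonempty set is its maximum if the set is finite and \<infinity> otherwise,
   and Inf of a nonempty set is its least element, so Sup and Inf are the maximum
   (equal to \<infinity> for unbounded sets) and the minimum. *)
definition curve_contact_order ::
  "(real \<Rightarrow> 'a::real_normed_vector) \<Rightarrow> (real \<Rightarrow> 'a) \<Rightarrow> enat" where
  "curve_contact_order g g' =
     Sup {enat l | l. (\<lambda>t. norm (g t - g' t)) \<in> o[at 0](\<lambda>t. \<bar>t\<bar> ^ l)}"

end

theory Submission imports Defs begin

text \<open>
Both inequalities compare a parametrization \<open>q\<close> of \<open>M\<close> near \<open>x0\<close> with one of \<open>M'\<close> on the same
parameter domain. Write \<open>s = n\<close>, a natural number because \<open>s < r\<close>.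

Lower bound (\<open>contact_ge_in_every_direction\<close>). If \<open>q' - q = o(|u - u0|^n)\<close>, then restricting to the
line \<open>u0 + t w\<close> with \<open>Dq(u0) w = v\<close> gives curves in \<open>M\<close> and \<open>M'\<close> whose distance is \<open>o(|t|^n)\<close>. For
\<open>n \<ge> 1\<close> this estimate also forces the second curve to have velocity \<open>v\<close>; for \<open>n = 0\<close> there is nothing
to prove.

Upper bound (\<open>contact_le_in_some_direction\<close>). The inverse of a parametrization \<open>q'\<close> of \<open>M'\<close> extends
to a \<open>C^r\<close> map \<open>F'\<close> on an open subset of the ambient space, so \<open>\<rho> = q' \<circ> F'\<close> is a \<open>C^r\<close> retraction of a
neighbourhood of \<open>x0\<close> onto \<open>M'\<close>. Since the tangent spaces agree, \<open>\<psi> = F' \<circ> q\<close> has an invertible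
derivative, so it is a local \<open>C^r\<close> diffeomorphism (\<open>Cr_on_inverse_function\<close>) and
\<open>\<rho> \<circ> q = q' \<circ> \<psi>\<close> is a parametrization of \<open>M'\<close> on the domain of \<open>q\<close>. As \<open>M\<close> and \<open>M'\<close> do not have order
of tangency \<open>n + 1\<close>, the map \<open>h = \<rho> \<circ> q - q\<close> is not \<open>o(|u - u0|^(n+1))\<close>, hence its Taylor
polynomial of degree \<open>n + 1\<close> has a non-zero lowest homogeneous part \<open>P\<close>, say \<open>P(w) \<noteq> 0\<close>. Along every
parameter curve leaving \<open>u0\<close> with velocity \<open>c w\<close>, \<open>c \<noteq> 0\<close>, the map \<open>h\<close> is then not
\<open>o(|t|^(n+1))\<close> (\<open>not_smallo_imp_curves_not_smallo\<close>). Take \<open>v = Dq(u0) w\<close>. For admissible curves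
\<open>\<gamma> = q \<circ> a\<close> in \<open>M\<close> and \<open>\<gamma>'\<close> in \<open>M'\<close> one has
\<open>h(a(t)) = (\<rho>(\<gamma>(t)) - \<rho>(\<gamma>'(t))) - (\<gamma>(t) - \<gamma>'(t))\<close> because \<open>\<rho>\<close> fixes \<open>\<gamma>'\<close>. As \<open>\<rho>\<close> is Lipschitz near \<open>x0\<close>,
a contact of order \<open>n + 1\<close> between \<open>\<gamma>\<close> and \<open>\<gamma>'\<close> would make \<open>h(a(t))\<close> small to that order.

Comparing with the retraction \<open>\<rho>\<close> replaces the usual graph representation of the two manifolds over
their common tangent space.
\<close>

section \<open>Calculus of maps of class C-k\<close>

lemma Ck_on_Suc_has_derivative:
  assumes "Ck_on (Suc k) f S" "x \<in> S"
  shows "(f has_derivative frechet_derivative f (at x)) (at x)"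
  using assms by (simp add: frechet_derivative_works)

lemma Ck_on_cong:
  assumes "open S" "\<And>x. x \<in> S \<Longrightarrow> f x = g x" "Ck_on k f S"
  shows "Ck_on k g S"
  using assms(2,3)
proof (induction k arbitrary: f g)
  case 0
  then show ?case by (simp cong: continuous_on_cong)
next
  case (Suc k)
  have der: "(g has_derivative frechet_derivative f (at x)) (at x)" if "x \<in> S" for x
    using has_derivative_transform_within_open[OF Ck_on_Suc_has_derivative[OF Suc.prems(2) that] \<open>open S\<close> that]
      Suc.prems(1) by auto
  have eq: "frechet_derivative f (at x) = frechet_derivative g (at x)" if "x \<in> S" for x
    using frechet_derivative_at[OF der[OF that]] .
  have "Ck_on k (\<lambda>x. frechet_derivative g (at x) v) S" for v
    using Suc.IH[of "\<lambda>x. frechet_derivative f (at x) v" "\<lambda>x. frechet_derivative g (at x) v"] Suc.prems(2) eq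
    by simp
  then show ?case
    using der by (auto simp: differentiable_def)
qed

text \<open>Lets a derivative be exhibited by a formula; on an open set the values of the derivative
determine \<open>frechet_derivative\<close> there.\<close>
lemma Ck_on_SucI:
  assumes "open S" "\<And>x. x \<in> S \<Longrightarrow> (f has_derivative D x) (at x)"
    and "\<And>v. Ck_on k (\<lambda>x. D x v) S"
  shows "Ck_on (Suc k) f S"
proof -
  have eq: "D x = frechet_derivative f (at x)" if "x \<in> S" for x
    using frechet_derivative_at[OF assms(2)[OF that]] .
  have "Ck_on k (\<lambda>x. frechet_derivative f (at x) v) S" for v
    using Ck_on_cong[OF \<open>open S\<close> _ assms(3)[of v], of "\<lambda>x. frechet_derivative f (at x) v"] eq by simp
  then show ?thesis
    using assms(2) by (auto simp: differentiable_def)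
qed

lemma Ck_on_Suc_imp_Ck_on: "Ck_on (Suc k) f S \<Longrightarrow> Ck_on k f S"
proof (induction k arbitrary: f)
  case 0
  then show ?case
    by (auto intro!: continuous_at_imp_continuous_on differentiable_imp_continuous_within)
next
  case (Suc k)
  then show ?case using Ck_on.simps(2) by blast
qed

lemma Ck_on_le: "Ck_on n f S \<Longrightarrow> k \<le> n \<Longrightarrow> Ck_on k f S"
  by (induction n) (use Ck_on_Suc_imp_Ck_on le_Suc_eq in \<open>auto simp del: Ck_on.simps(2)\<close>)

lemma Ck_on_restrict: "Ck_on k f S \<Longrightarrow> T \<subseteq> S \<Longrightarrow> Ck_on k f T"
  by (induction k arbitrary: f) (auto intro: continuous_on_subset)

lemma Ck_on_const [simp]: "open S \<Longrightarrow> Ck_on k (\<lambda>x. c) S"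
  by (induction k arbitrary: c) (auto intro!: Ck_on_SucI[where D = "\<lambda>_ _. 0"] simp del: Ck_on.simps(2))

lemma Ck_on_bounded_linear:
  assumes "open S" "bounded_linear L"
  shows "Ck_on k L S"
proof (cases k)
  case 0
  then show ?thesis using assms linear_continuous_on by auto
next
  case (Suc n)
  have "Ck_on (Suc n) L S"
    by (rule Ck_on_SucI[where D = "\<lambda>_. L"]) (use assms bounded_linear_imp_has_derivative in auto)
  then show ?thesis using Suc by blast
qed

lemma Ck_on_add:
  assumes "open S"
  shows "Ck_on k f S \<Longrightarrow> Ck_on k g S \<Longrightarrow> Ck_on k (\<lambda>x. f x + g x) S"
proof (induction k arbitrary: f g)
  case 0
  then show ?case by (auto intro: continuous_on_add)
next
  case (Suc k)
  show ?case
    by (rule Ck_on_SucI[OF assms has_derivative_add[OF Ck_on_Suc_has_derivative[OF Suc.prems(1)]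
            Ck_on_Suc_has_derivative[OF Suc.prems(2)]]])
      (use Suc in auto)
qed

lemma Ck_on_sum:
  assumes "open S" "\<And>i. i \<in> I \<Longrightarrow> Ck_on k (f i) S"
  shows "Ck_on k (\<lambda>x. \<Sum>i\<in>I. f i x) S"
  using assms(2) by (induction I rule: infinite_finite_induct) (use assms(1) in \<open>auto intro: Ck_on_add\<close>)

lemma Ck_on_bilinear:
  assumes "bounded_bilinear p" "open S"
  shows "Ck_on k f S \<Longrightarrow> Ck_on k g S \<Longrightarrow> Ck_on k (\<lambda>x. p (f x) (g x)) S"
proof (induction k arbitrary: f g)
  case 0
  then show ?case using bounded_bilinear.continuous_on[OF assms(1)] by auto
next
  case (Suc k)
  show ?case
  proof (rule Ck_on_SucI[OF assms(2) bounded_bilinear.FDERIV[OF assms(1)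
          Ck_on_Suc_has_derivative[OF Suc.prems(1)] Ck_on_Suc_has_derivative[OF Suc.prems(2)]]])
    fix v
    have "Ck_on k f S" "Ck_on k g S"
      using Suc.prems Ck_on_Suc_imp_Ck_on by blast+
    then show "Ck_on k (\<lambda>x. p (f x) (frechet_derivative g (at x) v) + p (frechet_derivative f (at x) v) (g x)) S"
      using Suc by (intro Ck_on_add \<open>open S\<close> Suc.IH) auto
  qed
qed

lemmas Ck_on_mult = Ck_on_bilinear[OF bounded_bilinear_mult]
  and Ck_on_scaleR = Ck_on_bilinear[OF bounded_bilinear_scaleR]

lemma Ck_on_linear_compose:
  assumes "open S" "bounded_linear L"
  shows "Ck_on k f S \<Longrightarrow> Ck_on k (\<lambda>x. L (f x)) S"
proof (induction k arbitrary: f)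
  case 0
  then show ?case using assms(2) bounded_linear.continuous_on by auto
next
  case (Suc k)
  show ?case
    by (rule Ck_on_SucI[OF assms(1) bounded_linear.has_derivative[OF assms(2)
            Ck_on_Suc_has_derivative[OF Suc.prems]]])
      (use Suc in auto)
qed

lemma Ck_on_diff:
  assumes "open S" "Ck_on k f S" "Ck_on k g S"
  shows "Ck_on k (\<lambda>x. f x - g x) S"
  using Ck_on_add[OF assms(1,2) Ck_on_linear_compose[OF assms(1) bounded_linear_minus[OF bounded_linear_ident] assms(3)]]
  by simp

lemma Ck_on_prod:
  fixes f :: "'i \<Rightarrow> 'a::euclidean_space \<Rightarrow> real"
  assumes "open S" "\<And>i. i \<in> I \<Longrightarrow> Ck_on k (f i) S"
  shows "Ck_on k (\<lambda>x. \<Prod>i\<in>I. f i x) S"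
  using assms(2) by (induction I rule: infinite_finite_induct) (use assms(1) in \<open>auto intro: Ck_on_mult\<close>)

lemma Ck_on_inverse:
  fixes f :: "'a::euclidean_space \<Rightarrow> real"
  assumes "open S" "\<And>x. x \<in> S \<Longrightarrow> f x \<noteq> 0"
  shows "Ck_on k f S \<Longrightarrow> Ck_on k (\<lambda>x. inverse (f x)) S"
proof (induction k)
  case 0
  then show ?case using assms by (auto intro!: continuous_intros)
next
  case (Suc k)
  have "Ck_on k (\<lambda>x. inverse (f x)) S"
    using Suc Ck_on_Suc_imp_Ck_on by blast
  then show ?case
    using Suc.prems assms
    by (intro Ck_on_SucI[where f = "\<lambda>x. inverse (f x)" and D = "\<lambda>x v. - (inverse (f x) * frechet_derivative f (at x) v * inverse (f x))"]
        Deriv.has_derivative_inverse Ck_on_mult Ck_on_linear_compose[OF _ bounded_linear_minus[OF bounded_linear_ident]]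
        Ck_on_Suc_has_derivative) auto
qed

text \<open>The class of the derivative is only controlled in directions that do not vary with the point.
Expanding in a basis reduces a variable direction, as in the chain rule, to fixed ones with
variable scalar coefficients.\<close>
lemma has_derivative_euclidean_expand:
  assumes "(f has_derivative D) F"
  shows "D v = (\<Sum>b\<in>Basis. (v \<bullet> b) *\<^sub>R D b)"
proof -
  interpret D: bounded_linear D using assms has_derivative_bounded_linear by blast
  have "D v = D (\<Sum>b\<in>Basis. (v \<bullet> b) *\<^sub>R b)"
    by (simp add: euclidean_representation)
  then show ?thesis by (simp add: D.sum D.scaleR)
qed

lemma Ck_on_compose:
  assumes "open S" "open T" "g ` S \<subseteq> T"
  shows "Ck_on k f T \<Longrightarrow> Ck_on k g S \<Longrightarrow> Ck_on k (\<lambda>x. f (g x)) S"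
  using assms(3)
proof (induction k arbitrary: f)
  case 0
  then show ?case by (auto intro: continuous_on_compose2)
next
  case (Suc k)
  let ?D = "\<lambda>x v. \<Sum>b\<in>Basis. (frechet_derivative g (at x) v \<bullet> b) *\<^sub>R frechet_derivative f (at (g x)) b"
  show ?case
  proof (rule Ck_on_SucI[OF \<open>open S\<close>])
    fix x assume x: "x \<in> S"
    then have f: "(f has_derivative frechet_derivative f (at (g x))) (at (g x))"
      using Suc.prems by (intro Ck_on_Suc_has_derivative) auto
    show "((\<lambda>x. f (g x)) has_derivative ?D x) (at x)"
      using has_derivative_compose[OF Ck_on_Suc_has_derivative[OF Suc.prems(2) x] f]
      by (subst (asm) has_derivative_euclidean_expand[OF f]) simp
  next
    fix v
    have g: "Ck_on k g S" using Suc.prems Ck_on_Suc_imp_Ck_on by blast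
    show "Ck_on k (\<lambda>x. ?D x v) S"
      using Suc.prems g
      by (intro Ck_on_sum Ck_on_scaleR \<open>open S\<close> Suc.IH Ck_on_linear_compose[OF _ bounded_linear_inner_left]) auto
  qed
qed

lemma Cr_on_restrict: "Cr_on r f S \<Longrightarrow> T \<subseteq> S \<Longrightarrow> Cr_on r f T"
  unfolding Cr_on_def using Ck_on_restrict by blast

lemma Cr_on_compose:
  "open S \<Longrightarrow> open T \<Longrightarrow> g ` S \<subseteq> T \<Longrightarrow> Cr_on r f T \<Longrightarrow> Cr_on r g S \<Longrightarrow> Cr_on r (\<lambda>x. f (g x)) S"
  unfolding Cr_on_def using Ck_on_compose by blast

lemma Cr_on_imp_continuous_on: "Cr_on r f S \<Longrightarrow> continuous_on S f"
  unfolding Cr_on_def by (metis Ck_on.simps(1) i0_lb zero_enat_def)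

lemma Cr_on_has_derivative:
  assumes "1 \<le> r" "Cr_on r f S" "x \<in> S"
  shows "(f has_derivative frechet_derivative f (at x)) (at x)"
proof -
  have "Ck_on (Suc 0) f S"
    using assms by (simp add: Cr_on_def one_enat_def del: Ck_on.simps)
  then show ?thesis using Ck_on_Suc_has_derivative assms(3) by blast
qed

section \<open>The inverse function theorem for class C-r\<close>
lemma Ck_on_vecI:
  fixes f :: "'a::euclidean_space \<Rightarrow> real ^ 'n"
  assumes "open S" "\<And>i. Ck_on k (\<lambda>x. f x $ i) S"
  shows "Ck_on k f S"
proof -
  have "Ck_on k (\<lambda>x. \<Sum>i\<in>UNIV. (f x $ i) *\<^sub>R axis i (1::real)) S"
    using assms by (intro Ck_on_sum Ck_on_scaleR) auto
  then show ?thesis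
    by (rule Ck_on_cong[OF assms(1), rotated])
      (simp add: basis_expansion flip: scalar_mult_eq_scaleR)
qed

lemma Ck_on_det:
  fixes A :: "'a::euclidean_space \<Rightarrow> real ^ 'n ^ 'n"
  assumes "open S" "\<And>i j. Ck_on k (\<lambda>x. A x $ i $ j) S"
  shows "Ck_on k (\<lambda>x. det (A x)) S"
  unfolding det_def
proof (rule Ck_on_sum[OF assms(1)])
  fix p
  have "Ck_on k (\<lambda>x. \<Prod>i\<in>UNIV. A x $ i $ p i) S"
    by (rule Ck_on_prod[OF assms(1)]) (rule assms(2))
  then show "Ck_on k (\<lambda>x. of_int (sign p) * (\<Prod>i\<in>UNIV. A x $ i $ p i)) S"
    by (rule Ck_on_mult[OF assms(1) Ck_on_const[OF assms(1)]])
qed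

text \<open>By Cramer's rule each coordinate of \<open>inv (A x) v\<close> is a quotient of determinants, that is, of
polynomials in the entries of the matrix of \<open>A x\<close>.\<close>
lemma Ck_on_inv_linear:
  fixes A :: "'a::euclidean_space \<Rightarrow> real ^ 'n \<Rightarrow> real ^ 'n"
  assumes "open S" "\<And>x. x \<in> S \<Longrightarrow> linear (A x)" "\<And>x. x \<in> S \<Longrightarrow> bij (A x)"
    and "\<And>v. Ck_on k (\<lambda>x. A x v) S"
  shows "Ck_on k (\<lambda>x. inv (A x) v) S"
proof -
  let ?B = "\<lambda>x l. (\<chi> i j. if j = l then v $ i else matrix (A x) $ i $ j)"
  have mat: "Ck_on k (\<lambda>x. matrix (A x) $ i $ j) S" for i j
    unfolding matrix_def vec_lambda_beta
    by (rule Ck_on_linear_compose[OF \<open>open S\<close> bounded_linear_vec_nth assms(4)])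
  have B: "Ck_on k (\<lambda>x. ?B x l $ i $ j) S" for l i j
    unfolding vec_lambda_beta by (cases "j = l") (simp_all add: mat \<open>open S\<close>)
  have det: "det (matrix (A x)) \<noteq> 0" if "x \<in> S" for x
    using det_nz_iff_inj[OF assms(2)[OF that]] bij_is_inj[OF assms(3)[OF that]] by blast
  have inv: "inv (A x) v $ l = det (?B x l) * inverse (det (matrix (A x)))" if "x \<in> S" for x l
  proof -
    have "matrix (A x) *v inv (A x) v = v"
      using fun_cong[OF matrix_vector_mul(2)[OF assms(2)[OF that]]] surj_f_inv_f[OF bij_is_surj[OF assms(3)[OF that]]] by simp
    then have "inv (A x) v = (\<chi> k. det (?B x k) / det (matrix (A x)))"
      by (rule iffD1[OF cramer[OF det[OF that]]])
    then show ?thesis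
      by (simp only: vec_lambda_beta divide_inverse)
  qed
  have "Ck_on k (\<lambda>x. inv (A x) v $ l) S" for l
    by (rule Ck_on_cong[OF \<open>open S\<close> _ Ck_on_mult[OF \<open>open S\<close> Ck_on_det[OF \<open>open S\<close> B]
            Ck_on_inverse[OF \<open>open S\<close> det Ck_on_det[OF \<open>open S\<close> mat]]]])
      (rule inv[symmetric])
  then show ?thesis by (rule Ck_on_vecI[OF \<open>open S\<close>])
qed

text \<open>The differentiable inverse \<open>g\<close> satisfies \<open>Dg(y) = (Df(g(y)))\<^sup>-\<^sup>1\<close>. If \<open>f\<close> is of class \<open>C^(k+1)\<close> and
\<open>g\<close> of class \<open>C^k\<close>, the right-hand side is of class \<open>C^k\<close>, so \<open>g\<close> is of class \<open>C^(k+1)\<close>. The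
neighbourhoods do not depend on \<open>k\<close>, which gives the case \<open>r = \<infinity>\<close> as well.\<close>
lemma Cr_on_inverse_function:
  fixes f :: "real ^ 'n \<Rightarrow> real ^ 'n"
  assumes "1 \<le> r" "open U" "Cr_on r f U" "x0 \<in> U" "inj (frechet_derivative f (at x0))"
  obtains A B g where "open A" "A \<subseteq> U" "x0 \<in> A" "open B" "homeomorphism A B f g" "Cr_on r g B"
proof -
  define D where "D x = frechet_derivative f (at x)" for x
  have der: "(f has_derivative D x) (at x)" if "x \<in> U" for x
    unfolding D_def using Cr_on_has_derivative assms(1,3) that by blast
  have bl: "bounded_linear (D x)" if "x \<in> U" for x
    using der[OF that] has_derivative_bounded_linear by blast
  have CkD: "Ck_on k (\<lambda>x. D x v) U" if "enat (Suc k) \<le> r" for k v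
    using that assms(3) unfolding Cr_on_def D_def by auto
  define D' where "D' x = Blinfun (D x)" for x
  have D': "blinfun_apply (D' x) = D x" if "x \<in> U" for x
    unfolding D'_def using bl[OF that] by (simp add: bounded_linear_Blinfun_apply)
  have der': "(f has_derivative blinfun_apply (D' x)) (at x)" if "x \<in> U" for x
    using der that by (simp add: D')
  have contD': "continuous_on U D'"
  proof (rule continuous_on_blinfun_componentwise)
    fix b :: "real ^ 'n"
    have "continuous_on U (\<lambda>x. D x b)"
      using CkD[of 0 b] assms(1) by (simp add: one_enat_def)
    then show "continuous_on U (\<lambda>x. blinfun_apply (D' x) b)"
      by (simp add: D' cong: continuous_on_cong)
  qed
  have "linear (D x0)" using bl[OF assms(4)] bounded_linear.linear by blast
  moreover have "inj (D x0)" using assms(5) by (simp add: D_def)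
  ultimately obtain g0 where g0: "linear g0" "\<And>x. g0 (D x0 x) = x"
    using linear_injective_isomorphism by blast
  have inv: "Blinfun g0 o\<^sub>L D' x0 = id_blinfun"
    using g0 by (intro blinfun_eqI) (simp add: D'[OF assms(4)] bounded_linear_Blinfun_apply linear_conv_bounded_linear)
  obtain A B g g' where AB: "open A" "A \<subseteq> U" "x0 \<in> A" "open B" "homeomorphism A B f g"
    and g': "\<And>y. y \<in> B \<Longrightarrow> (g has_derivative g' y) (at y)"
      "\<And>y. y \<in> B \<Longrightarrow> g' y = inv (blinfun_apply (D' (g y)))"
    and bij: "\<And>y. y \<in> B \<Longrightarrow> bij (blinfun_apply (D' (g y)))"
    using inverse_function_theorem[OF assms(2) der' contD' assms(4) inv] by metis
  have gB: "g ` B = A" using AB(5) by (auto simp: homeomorphism_def)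
  have DA: "bij (D x)" if "x \<in> A" for x
  proof -
    have "f x \<in> B" "g (f x) = x" using that AB(5) by (auto simp: homeomorphism_def)
    then show ?thesis using bij[of "f x"] D'[of x] that AB(2) by auto
  qed
  have Ckg: "Ck_on k g B" if "enat k \<le> r" for k
    using that
  proof (induction k)
    case 0
    then show ?case using AB(5) by (auto simp: homeomorphism_def)
  next
    case (Suc k)
    have k: "enat k \<le> r" using Suc.prems by (meson enat_ord_simps(1) le_SucI order.refl order_trans)
    have "Ck_on k (\<lambda>x. inv (D x) v) A" for v
    proof (rule Ck_on_inv_linear[OF AB(1)])
      show "linear (D x)" if "x \<in> A" for x
        using bl bounded_linear.linear that AB(2) by blast
    qed (use DA Ck_on_restrict[OF CkD[OF Suc.prems] AB(2)] in auto)
    then have "Ck_on k (\<lambda>y. inv (D (g y)) v) B" for v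
      using Ck_on_compose[OF AB(4) AB(1), of g k "\<lambda>x. inv (D x) v"] gB Suc.IH[OF k] by blast
    moreover have "(g has_derivative inv (D (g y))) (at y)" if "y \<in> B" for y
    proof -
      have "g y \<in> U" using gB AB(2) that by auto
      then show ?thesis using g'[OF that] D' by simp
    qed
    ultimately show ?case by (intro Ck_on_SucI[OF AB(4)])
  qed
  show ?thesis
    by (rule that[OF AB]) (use Ckg in \<open>auto simp: Cr_on_def\<close>)
qed

section \<open>Taylor expansion and behaviour along curves\<close>

text \<open>Induction on \<open>n\<close>: the partial derivatives have expansions of order \<open>n\<close> with homogeneous terms
\<open>P b j\<close>; integrating them along the segment from \<open>a\<close> to \<open>a + y\<close> gives the terms for \<open>h\<close>. The mean
value inequality replaces the integral. Continuity and homogeneity are the only properties of the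
Taylor terms that matter later, so they are not required to be polynomials.\<close>
lemma Ck_on_Taylor:
  fixes h :: "'a::euclidean_space \<Rightarrow> 'b::euclidean_space"
  assumes "open S" "a \<in> S" "Ck_on n h S"
  shows "\<exists>P :: nat \<Rightarrow> 'a \<Rightarrow> 'b.
    (\<forall>j. continuous_on UNIV (P j)) \<and> (\<forall>j c y. P j (c *\<^sub>R y) = c ^ j *\<^sub>R P j y) \<and>
    (\<forall>e>0. \<exists>d>0. \<forall>y. norm y < d \<longrightarrow> norm (h (a + y) - (\<Sum>j\<le>n. P j y)) \<le> e * norm y ^ n)"
  using assms(3)
proof (induction n arbitrary: h)
  case 0
  let ?P = "\<lambda>j y. if j = 0 then h a else (0::'b)"
  have "isCont h a"
    using 0 assms(1,2) by (simp add: continuous_on_eq_continuous_at)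
  then have "\<exists>d>0. \<forall>y. norm y < d \<longrightarrow> norm (h (a + y) - h a) \<le> e" if "e > 0" for e
  proof -
    obtain d where "d > 0" "\<And>x. dist x a < d \<Longrightarrow> dist (h x) (h a) < e"
      using \<open>isCont h a\<close> \<open>e > 0\<close> unfolding continuous_at_eps_delta by blast
    then have "norm (h (a + y) - h a) \<le> e" if "norm y < d" for y
      using that by (metis add_diff_cancel_left' dist_norm less_imp_le)
    then show ?thesis using \<open>d > 0\<close> by blast
  qed
  then show ?case
    by (intro exI[of _ ?P]) auto
next
  case (Suc n)
  let ?h' = "\<lambda>x. frechet_derivative h (at x)"
  have der: "(h has_derivative ?h' x) (at x)" if "x \<in> S" for x
    using Ck_on_Suc_has_derivative[OF Suc.prems that] .
  have "\<exists>P :: nat \<Rightarrow> 'a \<Rightarrow> 'b.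
    (\<forall>j. continuous_on UNIV (P j)) \<and> (\<forall>j c y. P j (c *\<^sub>R y) = c ^ j *\<^sub>R P j y) \<and>
    (\<forall>e>0. \<exists>d>0. \<forall>y. norm y < d \<longrightarrow> norm (?h' (a + y) b - (\<Sum>j\<le>n. P j y)) \<le> e * norm y ^ n)" for b
    using Suc.IH[of "\<lambda>x. ?h' x b"] Suc.prems by simp
  then obtain P :: "'a \<Rightarrow> nat \<Rightarrow> 'a \<Rightarrow> 'b" where
    Pcont: "\<And>b j. continuous_on UNIV (P b j)" and
    Phom: "\<And>b j c y. P b j (c *\<^sub>R y) = c ^ j *\<^sub>R P b j y" and
    Prem: "\<And>b e. e > 0 \<Longrightarrow> \<exists>d>0. \<forall>y. norm y < d \<longrightarrow>
      norm (?h' (a + y) b - (\<Sum>j\<le>n. P b j y)) \<le> e * norm y ^ n"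
    by metis
  \<comment> \<open>The factor \<open>1 / Suc i\<close> is the integral of \<open>t ^ i\<close> over the unit interval.\<close>
  define Q where "Q j y = (case j of 0 \<Rightarrow> h a
    | Suc i \<Rightarrow> (1 / real (Suc i)) *\<^sub>R (\<Sum>b\<in>Basis. (y \<bullet> b) *\<^sub>R P b i y))" for j y
  have Q: "Q 0 y = h a" "Q (Suc i) y = (1 / real (Suc i)) *\<^sub>R (\<Sum>b\<in>Basis. (y \<bullet> b) *\<^sub>R P b i y)" for i y
    by (auto simp: Q_def)
  have "continuous_on UNIV (Q j)" for j
  proof (cases j)
    case 0
    then show ?thesis by (simp add: Q_def)
  next
    case (Suc i)
    then show ?thesis using Pcont unfolding Q_def by (auto intro!: continuous_intros)
  qed
  moreover have "Q j (c *\<^sub>R y) = c ^ j *\<^sub>R Q j y" for j c y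
    by (cases j) (simp_all add: Q Phom scaleR_sum_right mult_ac)
  moreover have "\<exists>d>0. \<forall>y. norm y < d \<longrightarrow> norm (h (a + y) - (\<Sum>j\<le>Suc n. Q j y)) \<le> e * norm y ^ Suc n"
    if "e > 0" for e
  proof -
    define e' where "e' = e / real (DIM('a))"
    have e': "e' > 0" using that by (simp add: e'_def)
    obtain d where d: "\<And>b. d b > 0" "\<And>b y. norm y < d b \<Longrightarrow>
      norm (?h' (a + y) b - (\<Sum>j\<le>n. P b j y)) \<le> e' * norm y ^ n"
      using Prem[OF e'] by metis
    obtain d0 where d0: "d0 > 0" "ball a d0 \<subseteq> S"
      using assms(1,2) openE by blast
    define D where "D = min d0 (Min (d ` Basis))"
    have D: "D > 0" "D \<le> d0" "\<And>b. b \<in> Basis \<Longrightarrow> D \<le> d b"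
      using d(1) d0(1) by (auto simp: D_def min.coboundedI2)
    have "norm (h (a + y) - (\<Sum>j\<le>Suc n. Q j y)) \<le> e * norm y ^ Suc n" if y: "norm y < D" for y
    proof -
      \<comment> \<open>\<open>\<phi>\<close> is the remainder along the segment, without the constant term \<open>Q 0 y\<close>, so that
        \<open>\<phi> 0 = h a\<close> and \<open>\<phi> 1 - \<phi> 0\<close> is the full remainder at \<open>y\<close>.\<close>
      define \<phi> where "\<phi> t = h (a + t *\<^sub>R y) - (\<Sum>j\<le>n. t ^ Suc j *\<^sub>R Q (Suc j) y)" for t
      define \<phi>' where "\<phi>' t = ?h' (a + t *\<^sub>R y) y - (\<Sum>j\<le>n. (real (Suc j) * t ^ j) *\<^sub>R Q (Suc j) y)" for t
      have small: "norm (t *\<^sub>R y) < D" "norm (t *\<^sub>R y) \<le> norm y" if "t \<in> {0..1}" for t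
        using that y by (auto simp: mult_left_le_one_le intro: le_less_trans[OF mult_left_le_one_le])
      have inS: "a + t *\<^sub>R y \<in> S" if "t \<in> {0..1}" for t
        using small(1)[OF that] D(2) d0(2) by (auto simp: dist_norm)
      have derphi: "(\<phi> has_vector_derivative \<phi>' t) (at t within {0..1})" if "t \<in> {0..1}" for t
      proof -
        interpret bounded_linear "?h' (a + t *\<^sub>R y)"
          using der[OF inS[OF that]] has_derivative_bounded_linear by blast
        have 1: "((\<lambda>t. a + t *\<^sub>R y) has_derivative (\<lambda>s. s *\<^sub>R y)) (at t within {0..1})"
          by (auto intro!: derivative_eq_intros)
        have 2: "((\<lambda>t. h (a + t *\<^sub>R y)) has_vector_derivative ?h' (a + t *\<^sub>R y) y) (at t within {0..1})"
          using has_derivative_compose[OF 1 der[OF inS[OF that]]]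
          by (simp add: has_vector_derivative_def scaleR)
        have "((\<lambda>t. t ^ Suc j *\<^sub>R Q (Suc j) y) has_vector_derivative (real (Suc j) * t ^ j) *\<^sub>R Q (Suc j) y)
            (at t within {0..1})" for j
          using has_vector_derivative_scaleR[OF DERIV_pow[of "Suc j" t "{0..1}"] has_vector_derivative_const[of "Q (Suc j) y"]]
          by simp
        then show ?thesis
          unfolding \<phi>_def \<phi>'_def
          by (intro has_vector_derivative_diff[OF 2] has_vector_derivative_sum)
      qed
      have bound: "norm (\<phi>' t) \<le> e * norm y ^ Suc n" if t: "t \<in> {0..1}" for t
      proof -
        have "?h' (a + t *\<^sub>R y) y = (\<Sum>b\<in>Basis. (y \<bullet> b) *\<^sub>R ?h' (a + t *\<^sub>R y) b)"
          by (rule has_derivative_euclidean_expand[OF der[OF inS[OF t]]])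
        moreover have "(\<Sum>j\<le>n. (real (Suc j) * t ^ j) *\<^sub>R Q (Suc j) y)
          = (\<Sum>j\<le>n. \<Sum>b\<in>Basis. (y \<bullet> b) *\<^sub>R P b j (t *\<^sub>R y))"
          by (intro sum.cong refl) (simp add: Q Phom scaleR_sum_right mult_ac del: of_nat_Suc)
        moreover have "\<dots> = (\<Sum>b\<in>Basis. (y \<bullet> b) *\<^sub>R (\<Sum>j\<le>n. P b j (t *\<^sub>R y)))"
          by (subst sum.swap) (simp add: scaleR_sum_right)
        ultimately have "\<phi>' t = (\<Sum>b\<in>Basis. (y \<bullet> b) *\<^sub>R (?h' (a + t *\<^sub>R y) b - (\<Sum>j\<le>n. P b j (t *\<^sub>R y))))"
          unfolding \<phi>'_def by (simp add: sum_subtractf scaleR_diff_right)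
        then have "norm (\<phi>' t) \<le> (\<Sum>b\<in>Basis. \<bar>y \<bullet> b\<bar> * norm (?h' (a + t *\<^sub>R y) b - (\<Sum>j\<le>n. P b j (t *\<^sub>R y))))"
          by (auto intro!: order_trans[OF norm_sum])
        also have "\<dots> \<le> (\<Sum>b\<in>(Basis::'a set). norm y * (e' * norm y ^ n))"
        proof (intro sum_mono mult_mono)
          fix b :: 'a assume b: "b \<in> Basis"
          show "\<bar>y \<bullet> b\<bar> \<le> norm y" using Basis_le_norm[OF b] .
          have "norm (?h' (a + t *\<^sub>R y) b - (\<Sum>j\<le>n. P b j (t *\<^sub>R y))) \<le> e' * norm (t *\<^sub>R y) ^ n"
            using small(1)[OF t] D(3)[OF b] by (intro d(2)) auto
          also have "\<dots> \<le> e' * norm y ^ n"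
            using e' small(2)[OF t] by (intro mult_left_mono power_mono) auto
          finally show "norm (?h' (a + t *\<^sub>R y) b - (\<Sum>j\<le>n. P b j (t *\<^sub>R y))) \<le> e' * norm y ^ n" .
        qed auto
        also have "\<dots> = e * norm y ^ Suc n"
          by (simp add: e'_def)
        finally show ?thesis .
      qed
      have "norm (\<phi> 1 - \<phi> 0) \<le> (e * norm y ^ Suc n) * norm (1 - 0 :: real)"
      proof (rule differentiable_bound[of "{0..1}" \<phi> "\<lambda>t s. s *\<^sub>R \<phi>' t"])
        show "(\<phi> has_derivative (\<lambda>s. s *\<^sub>R \<phi>' t)) (at t within {0..1})" if "t \<in> {0..1}" for t
          using derphi[OF that] by (simp add: has_vector_derivative_def)
        show "onorm (\<lambda>s. s *\<^sub>R \<phi>' t) \<le> e * norm y ^ Suc n" if "t \<in> {0..1}" for t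
        proof (rule onorm_bound)
          fix s
          have "\<bar>s\<bar> * norm (\<phi>' t) \<le> \<bar>s\<bar> * (e * norm y ^ Suc n)"
            by (rule mult_left_mono[OF bound[OF that]]) simp
          then show "norm (s *\<^sub>R \<phi>' t) \<le> e * norm y ^ Suc n * norm s"
            by (simp only: norm_scaleR real_norm_def mult.commute)
        qed (use \<open>e > 0\<close> in simp)
      qed auto
      moreover have "\<phi> 1 - \<phi> 0 = h (a + y) - (\<Sum>j\<le>Suc n. Q j y)"
        unfolding \<phi>_def by (subst sum.atMost_Suc_shift) (simp add: Q(1))
      ultimately show ?thesis by simp
    qed
    then show ?thesis using D(1) by blast
  qed
  ultimately show ?case by (intro exI[of _ Q]) blast
qed

lemma smallo_mono_norm:
  fixes g :: "'a \<Rightarrow> real"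
  assumes "g \<in> o[F](k)" "\<forall>\<^sub>F x in F. norm (f x) \<le> g x"
  shows "(\<lambda>x. norm (f x)) \<in> o[F](k)"
proof (rule landau_o.big_small_trans[OF _ assms(1)], rule landau_o.bigI[of 1])
  show "\<forall>\<^sub>F x in F. norm (norm (f x)) \<le> 1 * norm (g x)"
    using assms(2) by eventually_elim simp
qed simp

lemma abs_power_bigo: "j \<le> n \<Longrightarrow> (\<lambda>t::real. \<bar>t\<bar> ^ n) \<in> O[at 0](\<lambda>t. \<bar>t\<bar> ^ j)"
proof (rule landau_o.bigI[of 1])
  assume "j \<le> n"
  then have le: "norm (\<bar>t\<bar> ^ n) \<le> 1 * norm (\<bar>t\<bar> ^ j)" if "\<bar>t\<bar> < 1" for t :: real
    using that power_decreasing[of j n "\<bar>t\<bar>"] by (simp add: power_abs)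
  show "\<forall>\<^sub>F t in at (0::real). norm (\<bar>t\<bar> ^ n) \<le> 1 * norm (\<bar>t\<bar> ^ j)"
    unfolding eventually_at
    by (intro exI[of _ 1] conjI zero_less_one ballI impI le) (simp add: dist_real_def)
qed simp

text \<open>Choose \<open>w\<close> with \<open>P j w \<noteq> 0\<close>, where \<open>P j\<close> is the lowest non-zero Taylor term; then \<open>j \<le> n\<close>. On a
curve \<open>\<beta> t = a + t *\<^sub>R z t\<close> with \<open>z t \<rightarrow> c *\<^sub>R w\<close>, homogeneity gives
\<open>h (\<beta> t) / t ^ j \<rightarrow> P j (c *\<^sub>R w) = c ^ j *\<^sub>R P j w \<noteq> 0\<close>. Only the direction of the velocity of
\<open>\<beta>\<close> decides whether the limit vanishes.\<close>
lemma not_smallo_imp_curves_not_smallo: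
  fixes h :: "'a::euclidean_space \<Rightarrow> 'b::euclidean_space"
  assumes "open S" "a \<in> S" "Ck_on n h S"
    and not_small: "(\<lambda>x. norm (h x)) \<notin> o[at a](\<lambda>x. norm (x - a) ^ n)"
  obtains w where "\<And>\<beta> c. \<beta> 0 = a \<Longrightarrow> c \<noteq> 0 \<Longrightarrow> (\<beta> has_vector_derivative c *\<^sub>R w) (at 0) \<Longrightarrow>
    (\<lambda>t. norm (h (\<beta> t))) \<notin> o[at 0](\<lambda>t::real. \<bar>t\<bar> ^ n)"
proof -
  obtain P :: "nat \<Rightarrow> 'a \<Rightarrow> 'b" where cont: "\<And>j. continuous_on UNIV (P j)"
    and hom: "\<And>j c y. P j (c *\<^sub>R y) = c ^ j *\<^sub>R P j y"
    and rem: "\<And>e. e > 0 \<Longrightarrow>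
      \<exists>d>0. \<forall>y. norm y < d \<longrightarrow> norm (h (a + y) - (\<Sum>j\<le>n. P j y)) \<le> e * norm y ^ n"
    using Ck_on_Taylor[OF assms(1-3)] by blast
  have "\<exists>j\<le>n. \<exists>w. P j w \<noteq> 0"
  proof (rule ccontr)
    assume "\<not> ?thesis"
    then have P0: "P j y = 0" if "j \<le> n" for j y using that by blast
    have "(\<lambda>x. norm (h x)) \<in> o[at a](\<lambda>x. norm (x - a) ^ n)"
    proof (rule landau_o.smallI)
      fix e :: real assume "e > 0"
      then obtain d where "d > 0" and d: "\<And>y. norm y < d \<Longrightarrow> norm (h (a + y)) \<le> e * norm y ^ n"
        using rem P0 by fastforce
      have "norm (norm (h x)) \<le> e * norm (norm (x - a) ^ n)" if "dist x a < d" for x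
        using d[of "x - a"] that by (simp add: dist_norm)
      then show "\<forall>\<^sub>F x in at a. norm (norm (h x)) \<le> e * norm (norm (x - a) ^ n)"
        unfolding eventually_at using \<open>d > 0\<close> by blast
    qed
    then show False using not_small by blast
  qed
  then obtain j where j: "j \<le> n" "\<exists>w. P j w \<noteq> 0" and least: "\<And>i. i < j \<Longrightarrow> \<not> (i \<le> n \<and> (\<exists>w. P i w \<noteq> 0))"
    using exists_least_iff[of "\<lambda>j. j \<le> n \<and> (\<exists>w. P j w \<noteq> 0)"] by blast
  obtain w where w: "P j w \<noteq> 0" using j(2) by blast
  have low: "P i y = 0" if "i < j" for i y using least[OF that] that j(1) by auto
  show ?thesis
  proof (rule that, rule notI)
    fix \<beta> c
    assume \<beta>0: "\<beta> 0 = a" and c: "c \<noteq> 0" and \<beta>: "(\<beta> has_vector_derivative c *\<^sub>R w) (at 0)"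
      and small: "(\<lambda>t. norm (h (\<beta> t))) \<in> o[at 0](\<lambda>t::real. \<bar>t\<bar> ^ n)"
    define z where "z t = (\<beta> t - a) /\<^sub>R t" for t
    have z: "(z \<longlongrightarrow> c *\<^sub>R w) (at 0)"
    proof -
      have "((\<lambda>t. (\<beta> t - a - (t * c) *\<^sub>R w) /\<^sub>R \<bar>t\<bar>) \<longlongrightarrow> 0) (at 0)"
        using \<beta> \<beta>0 by (simp add: has_vector_derivative_def has_derivative_def)
      moreover have "norm ((\<beta> t - a - (t * c) *\<^sub>R w) /\<^sub>R \<bar>t\<bar>) = norm (z t - c *\<^sub>R w)" if "t \<noteq> 0" for t
      proof -
        have "\<beta> t - a - (t * c) *\<^sub>R w = t *\<^sub>R (z t - c *\<^sub>R w)"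
          using that by (simp add: z_def scaleR_diff_right)
        then show ?thesis using that by (simp add: abs_mult)
      qed
      ultimately show ?thesis
        unfolding tendsto_iff by (simp add: eventually_at_filter dist_norm)
    qed
    have \<beta>z: "\<beta> t = a + t *\<^sub>R z t" if "t \<noteq> 0" for t
      using that by (simp add: z_def)
    have ev: "\<forall>\<^sub>F t in at (0::real). t \<noteq> 0" by (simp add: eventually_at_filter)
    define R where "R y = h (a + y) - (\<Sum>j\<le>n. P j y)" for y
    have z1: "\<forall>\<^sub>F t in at 0. norm (z t) < norm (c *\<^sub>R w) + 1"
      using tendsto_norm[OF z] by (rule order_tendstoD) simp
    have tz: "((\<lambda>t. norm (t *\<^sub>R z t)) \<longlongrightarrow> 0) (at 0)"
      using tendsto_norm[OF tendsto_scaleR[OF tendsto_ident_at z]] by simp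
    have Rsmall: "(\<lambda>t. norm (R (t *\<^sub>R z t))) \<in> o[at 0](\<lambda>t::real. \<bar>t\<bar> ^ n)"
    proof (rule landau_o.smallI)
      fix e :: real assume "e > 0"
      define K where "K = (norm (c *\<^sub>R w) + 1) ^ n"
      have "K > 0" by (simp add: K_def add_nonneg_pos)
      obtain d where "d > 0" and d: "\<And>y. norm y < d \<Longrightarrow> norm (R y) \<le> (e / K) * norm y ^ n"
        using rem[of "e / K"] \<open>e > 0\<close> \<open>K > 0\<close> unfolding R_def by auto
      have "\<forall>\<^sub>F t in at 0. norm (t *\<^sub>R z t) < d"
        using tz \<open>d > 0\<close> by (rule order_tendstoD)
      with z1 show "\<forall>\<^sub>F t in at 0. norm (norm (R (t *\<^sub>R z t))) \<le> e * norm (\<bar>t\<bar> ^ n)"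
      proof eventually_elim
        case (elim t)
        have "norm (R (t *\<^sub>R z t)) \<le> (e / K) * norm (t *\<^sub>R z t) ^ n" using d elim(2) by blast
        also have "\<dots> = (e / K) * (\<bar>t\<bar> ^ n * norm (z t) ^ n)" by (simp add: power_mult_distrib)
        also have "\<dots> \<le> (e / K) * (\<bar>t\<bar> ^ n * K)"
          using elim(1) \<open>e > 0\<close> \<open>K > 0\<close> unfolding K_def by (intro mult_left_mono power_mono) auto
        finally show ?case using \<open>K > 0\<close> by (simp add: mult.commute)
      qed
    qed
    \<comment> \<open>The Taylor sum at \<open>\<beta> t\<close> differs from \<open>h (\<beta> t)\<close> by the remainder only, so it is small too.
      Divided by \<open>t ^ j\<close> it tends both to \<open>0\<close> and to \<open>P j (c *\<^sub>R w)\<close>.\<close>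
    let ?T = "\<lambda>t. (\<Sum>i\<le>n. t ^ i *\<^sub>R P i (z t))"
    have "(\<lambda>t. norm (h (\<beta> t)) + norm (R (t *\<^sub>R z t))) \<in> o[at 0](\<lambda>t::real. \<bar>t\<bar> ^ n)"
      using sum_in_smallo(1)[OF small Rsmall] .
    moreover have "\<forall>\<^sub>F t in at 0. norm (?T t) \<le> norm (h (\<beta> t)) + norm (R (t *\<^sub>R z t))"
      using ev
    proof eventually_elim
      case (elim t)
      have "?T t = h (\<beta> t) - R (t *\<^sub>R z t)"
        by (simp add: R_def \<beta>z[OF elim] hom)
      then show ?case using norm_triangle_ineq4 by metis
    qed
    ultimately have Tn: "(\<lambda>t. norm (?T t)) \<in> o[at 0](\<lambda>t::real. \<bar>t\<bar> ^ n)"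
      by (rule smallo_mono_norm)
    from landau_o.small_big_trans[OF Tn abs_power_bigo[OF j(1)]]
    have "((\<lambda>t. norm (?T t) / \<bar>t\<bar> ^ j) \<longlongrightarrow> 0) (at 0)"
      by (rule smalloD_tendsto)
    moreover have "\<forall>\<^sub>F t in at 0. norm (?T t) / \<bar>t\<bar> ^ j = norm (\<Sum>i\<in>{j..n}. t ^ (i - j) *\<^sub>R P i (z t))"
      using ev
    proof eventually_elim
      case (elim t)
      have "?T t = (\<Sum>i\<in>{j..n}. t ^ i *\<^sub>R P i (z t))"
        by (rule sum.mono_neutral_right) (auto simp: low)
      also have "\<dots> = t ^ j *\<^sub>R (\<Sum>i\<in>{j..n}. t ^ (i - j) *\<^sub>R P i (z t))"
        unfolding scaleR_sum_right by (intro sum.cong refl) (simp flip: power_add)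
      finally show ?case using elim by (simp add: power_abs)
    qed
    ultimately have "((\<lambda>t. norm (\<Sum>i\<in>{j..n}. t ^ (i - j) *\<^sub>R P i (z t))) \<longlongrightarrow> 0) (at 0)"
      using tendsto_cong by fast
    moreover have "((\<lambda>t. norm (\<Sum>i\<in>{j..n}. t ^ (i - j) *\<^sub>R P i (z t)))
      \<longlongrightarrow> norm (\<Sum>i\<in>{j..n}. 0 ^ (i - j) *\<^sub>R P i (c *\<^sub>R w))) (at 0)"
    proof -
      have "((\<lambda>t. P i (z t)) \<longlongrightarrow> P i (c *\<^sub>R w)) (at 0)" for i
        using cont[of i] z by (simp add: continuous_on_eq_continuous_at isCont_tendsto_compose)
      then show ?thesis by (intro tendsto_intros)
    qed
    ultimately have "(\<Sum>i\<in>{j..n}. 0 ^ (i - j) *\<^sub>R P i (c *\<^sub>R w)) = 0"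
      using LIM_unique norm_eq_zero by blast
    moreover have "(\<Sum>i\<in>{j..n}. 0 ^ (i - j) *\<^sub>R P i (c *\<^sub>R w)) = (\<Sum>i\<in>{j}. 0 ^ (i - j) *\<^sub>R P i (c *\<^sub>R w))"
      using j(1) by (intro sum.mono_neutral_right) (auto simp: power_0_left)
    ultimately show False using w c by (simp add: hom)
  qed
qed

section \<open>Parametrizations, charts and tangent vectors\<close>

text \<open>\<open>F\<close> inverts \<open>q\<close> and is defined on a neighbourhood in the ambient space, not only on \<open>M\<close>. Thus it
can be differentiated in all directions and applied to points off \<open>M\<close>, and \<open>q \<circ> F\<close> is a retraction
of \<open>W\<close> into \<open>M\<close> that fixes \<open>W \<inter> M\<close>.\<close>
definition ambient_chart ::
  "enat \<Rightarrow> 'a::euclidean_space set \<Rightarrow> 'p::euclidean_space set \<Rightarrow> ('p \<Rightarrow> 'a) \<Rightarrow>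
   'a set \<Rightarrow> ('a \<Rightarrow> 'p) \<Rightarrow> bool" where
  "ambient_chart r M U q W F \<longleftrightarrow> open W \<and> Cr_on r F W \<and> F ` W \<subseteq> U \<and>
     (\<forall>y\<in>W \<inter> M. q (F y) = y) \<and> (\<forall>u\<in>U. q u \<in> W \<longrightarrow> F (q u) = u)"

lemma ambient_chartD:
  assumes "ambient_chart r M U q W F"
  shows "open W" "Cr_on r F W" "F ` W \<subseteq> U"
    and "\<And>y. y \<in> W \<Longrightarrow> y \<in> M \<Longrightarrow> q (F y) = y" "\<And>u. u \<in> U \<Longrightarrow> q u \<in> W \<Longrightarrow> F (q u) = u"
  using assms by (auto simp: ambient_chart_def)

text \<open>The extension of \<open>inv_into U q\<close> agrees with it on \<open>q ` U\<close> only. Its domain is cut down to an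
open set \<open>N\<close> with \<open>M \<inter> N = q ` U\<close>, which keeps out other sheets of \<open>M\<close>, and to the points
that it sends into \<open>U\<close>.\<close>
lemma Cr_parametrization_ambient_chart:
  assumes "Cr_parametrization r M U q" "u0 \<in> U"
  obtains W F where "q u0 \<in> W" "ambient_chart r M U q W F"
proof -
  have U: "open U" "openin (top_of_set M) (q ` U)" "inj_on q U"
    and ext: "Cr_on_subset r (inv_into U q) (q ` U)"
    using assms(1) by (auto simp: Cr_parametrization_def)
  have "\<exists>W F. open W \<and> q u0 \<in> W \<and> Cr_on r F W \<and> (\<forall>y\<in>W \<inter> q ` U. F y = inv_into U q y)"
    using ext assms(2) by (simp add: Cr_on_subset_def)
  then obtain W F where W: "open W" "q u0 \<in> W" "Cr_on r F W"
    and F: "\<forall>y\<in>W \<inter> q ` U. F y = inv_into U q y"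
    by blast
  obtain N where N: "open N" "q ` U = M \<inter> N"
    using U(2) by (auto simp: openin_open)
  define V where "V = (W \<inter> N) \<inter> F -` U"
  have Fq: "F (q u) = u" if "u \<in> U" "q u \<in> W" for u
    using F that U(3) by simp
  have "open V"
    unfolding V_def using W(1,3) N(1) U(1)
    by (intro continuous_open_preimage continuous_on_subset[OF Cr_on_imp_continuous_on]) auto
  moreover have "q u0 \<in> V"
    using W(2) N(2) Fq[OF assms(2) W(2)] assms(2) by (auto simp: V_def)
  moreover have "Cr_on r F V"
    unfolding V_def by (rule Cr_on_restrict[OF W(3)]) blast
  moreover have "q (F y) = y" if "y \<in> V \<inter> M" for y
  proof -
    have "y \<in> W" "y \<in> q ` U" using that N(2) by (auto simp: V_def)
    then show ?thesis using F by (simp add: f_inv_into_f)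
  qed
  ultimately have "ambient_chart r M U q V F"
    using Fq by (auto simp: ambient_chart_def V_def)
  with \<open>q u0 \<in> V\<close> show ?thesis by (rule that)
qed

lemma Cr_parametrization_restrict:
  assumes q: "Cr_parametrization r M U q" and "open V" "V \<subseteq> U"
  shows "Cr_parametrization r M V q"
proof -
  have inj: "inj_on q U" "inj_on q V" and Cr: "Cr_on r q U"
    using q inj_on_subset[OF _ \<open>V \<subseteq> U\<close>] by (auto simp: Cr_parametrization_def)
  have "\<exists>T. openin (top_of_set M) T \<and> x \<in> T \<and> T \<subseteq> q ` V" if "x \<in> q ` V" for x
  proof -
    from that obtain u where u: "u \<in> V" "x = q u" by blast
    then have "u \<in> U" using \<open>V \<subseteq> U\<close> by blast
    then obtain W F where W: "q u \<in> W" and F: "ambient_chart r M U q W F"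
      using Cr_parametrization_ambient_chart[OF q] by blast
    have "open (W \<inter> F -` V)"
      using ambient_chartD(1)[OF F] Cr_on_imp_continuous_on[OF ambient_chartD(2)[OF F]] \<open>open V\<close>
      by (intro continuous_open_preimage)
    moreover have "x \<in> W \<inter> F -` V" using u W ambient_chartD(5)[OF F \<open>u \<in> U\<close>] by auto
    moreover have "x \<in> M"
      using q u \<open>V \<subseteq> U\<close> openin_imp_subset unfolding Cr_parametrization_def by blast
    moreover have "M \<inter> (W \<inter> F -` V) \<subseteq> q ` V"
    proof
      fix y assume y: "y \<in> M \<inter> (W \<inter> F -` V)"
      then have "q (F y) = y" by (intro ambient_chartD(4)[OF F]) auto
      then show "y \<in> q ` V" using y by (intro image_eqI[of _ _ "F y"]) auto
    qed
    ultimately show ?thesis by (intro exI[of _ "M \<inter> (W \<inter> F -` V)"]) (auto simp: openin_open)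
  qed
  then have "openin (top_of_set M) (q ` V)" by (subst openin_subopen) blast
  moreover have "Cr_on_subset r (inv_into V q) (q ` V)"
    unfolding Cr_on_subset_def
  proof
    fix x assume "x \<in> q ` V"
    then have "\<exists>W F. open W \<and> x \<in> W \<and> Cr_on r F W \<and> (\<forall>y\<in>W \<inter> q ` U. F y = inv_into U q y)"
      using q \<open>V \<subseteq> U\<close> unfolding Cr_parametrization_def Cr_on_subset_def by auto
    then obtain W F where "open W" "x \<in> W" "Cr_on r F W"
      and F: "\<forall>y\<in>W \<inter> q ` U. F y = inv_into U q y" by blast
    moreover have "F y = inv_into V q y" if "y \<in> W \<inter> q ` V" for y
    proof -
      obtain u where "u \<in> V" "y = q u" "y \<in> W" using \<open>y \<in> W \<inter> q ` V\<close> by blast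
      then show ?thesis using F inj \<open>V \<subseteq> U\<close> by (simp add: subset_iff)
    qed
    ultimately show "\<exists>W F. open W \<and> x \<in> W \<and> Cr_on r F W \<and> (\<forall>y\<in>W \<inter> q ` V. F y = inv_into V q y)"
      by blast
  qed
  ultimately show ?thesis
    using \<open>open V\<close> inj(2) Cr_on_restrict[OF Cr \<open>V \<subseteq> U\<close>] by (simp add: Cr_parametrization_def)
qed

lemma Cr_parametrization_reparametrize:
  assumes q: "Cr_parametrization r M U q" and "open A" "open B" "B \<subseteq> U"
    and hom: "homeomorphism A B \<psi> g" and Cr: "Cr_on r \<psi> A" "Cr_on r g B"
  shows "Cr_parametrization r M A (\<lambda>u. q (\<psi> u))"
proof -
  have qB: "Cr_parametrization r M B q"
    by (rule Cr_parametrization_restrict[OF q assms(3,4)])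
  then have B: "inj_on q B" "Cr_on r q B" "openin (top_of_set M) (q ` B)"
    by (auto simp: Cr_parametrization_def)
  have im: "\<psi> ` A = B" and g: "\<And>u. u \<in> A \<Longrightarrow> g (\<psi> u) = u"
    using hom by (auto simp: homeomorphism_def)
  have "(\<lambda>u. q (\<psi> u)) ` A = q ` B" using im by auto
  moreover have inj: "inj_on (\<lambda>u. q (\<psi> u)) A"
    using comp_inj_on[OF inj_on_inverseI[of A g \<psi>, OF g], of q] B(1) im by (simp add: o_def)
  moreover have "Cr_on r (\<lambda>u. q (\<psi> u)) A"
    using Cr_on_compose[OF assms(2,3) _ B(2) Cr(1)] im by simp
  moreover have "Cr_on_subset r (inv_into A (\<lambda>u. q (\<psi> u))) ((\<lambda>u. q (\<psi> u)) ` A)"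
    unfolding Cr_on_subset_def
  proof
    fix x assume "x \<in> (\<lambda>u. q (\<psi> u)) ` A"
    then obtain u where u: "u \<in> A" "x = q (\<psi> u)" by blast
    then have "\<psi> u \<in> B" using im by blast
    then obtain W F where W: "q (\<psi> u) \<in> W" and F: "ambient_chart r M B q W F"
      using Cr_parametrization_ambient_chart[OF qB] by blast
    have "Cr_on r (\<lambda>y. g (F y)) W"
      using Cr_on_compose[OF ambient_chartD(1)[OF F] \<open>open B\<close> ambient_chartD(3)[OF F] Cr(2) ambient_chartD(2)[OF F]] .
    moreover have "g (F y) = inv_into A (\<lambda>u. q (\<psi> u)) y" if "y \<in> W \<inter> (\<lambda>u. q (\<psi> u)) ` A" for y
    proof -
      from that obtain u' where u': "u' \<in> A" "y = q (\<psi> u')" "y \<in> W" by blast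
      then have "F y = \<psi> u'" using ambient_chartD(5)[OF F, of "\<psi> u'"] im by blast
      then show ?thesis using u' g inv_into_f_f[OF inj u'(1)] by simp
    qed
    ultimately show "\<exists>W F. open W \<and> x \<in> W \<and> Cr_on r F W \<and>
        (\<forall>y\<in>W \<inter> (\<lambda>u. q (\<psi> u)) ` A. F y = inv_into A (\<lambda>u. q (\<psi> u)) y)"
      using W u(2) ambient_chartD(1)[OF F] by blast
  qed
  ultimately show ?thesis using B(3) \<open>open A\<close> by (simp add: Cr_parametrization_def)
qed

lemma Cr_curve_has_vector_derivative:
  assumes "1 \<le> r" "Cr_curve r M x \<gamma>"
  shows "(\<gamma> has_vector_derivative velocity \<gamma>) (at 0)"
proof -
  obtain e where "e > 0" "Cr_on r \<gamma> {-e<..<e}"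
    using assms(2) by (auto simp: Cr_curve_def)
  then have "\<gamma> differentiable at 0"
    using Cr_on_has_derivative[OF assms(1), of \<gamma> "{-e<..<e}" 0] by (auto simp: differentiable_def)
  then show ?thesis by (simp add: vector_derivative_works)
qed

lemma Cr_curve_eventually_in:
  assumes "Cr_curve r M x \<gamma>" "open W" "x \<in> W"
  shows "\<forall>\<^sub>F t in nhds 0. \<gamma> t \<in> W \<inter> M"
proof -
  obtain e where e: "e > 0" "Cr_on r \<gamma> {-e<..<e}" "\<gamma> ` {-e<..<e} \<subseteq> M" and "\<gamma> 0 = x"
    using assms(1) by (auto simp: Cr_curve_def)
  have "open ({-e<..<e} \<inter> \<gamma> -` W)"
    using Cr_on_imp_continuous_on[OF e(2)] assms(2) by (intro continuous_open_preimage) auto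
  moreover have "0 \<in> {-e<..<e} \<inter> \<gamma> -` W" using e(1) \<open>\<gamma> 0 = x\<close> assms(3) by auto
  ultimately show ?thesis
    unfolding eventually_nhds using e(3) by (intro exI[of _ "{-e<..<e} \<inter> \<gamma> -` W"]) auto
qed

lemma parametrization_line_curve:
  assumes "1 \<le> r" "Cr_parametrization r M U q" "u0 \<in> U"
  shows "Cr_curve r M (q u0) (\<lambda>t. q (u0 + t *\<^sub>R w))"
    and "((\<lambda>t. q (u0 + t *\<^sub>R w)) has_vector_derivative frechet_derivative q (at u0) w) (at 0)"
proof -
  have q: "open U" "Cr_on r q U" "q ` U \<subseteq> M"
    using assms(2) openin_subset[of "top_of_set M" "q ` U"] by (auto simp: Cr_parametrization_def)
  have cont: "continuous_on UNIV (\<lambda>t. u0 + t *\<^sub>R w)" by (intro continuous_intros)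
  then have "open ((\<lambda>t. u0 + t *\<^sub>R w) -` U)"
    using q(1) open_vimage by blast
  moreover have "0 \<in> (\<lambda>t. u0 + t *\<^sub>R w) -` U" using assms(3) by simp
  ultimately obtain e where e: "e > 0" "ball 0 e \<subseteq> (\<lambda>t. u0 + t *\<^sub>R w) -` U"
    using openE by blast
  have sub: "(\<lambda>t. u0 + t *\<^sub>R w) ` {-e<..<e} \<subseteq> U"
    using e(2) by (auto simp: subset_iff)
  have "Cr_on r (\<lambda>t. u0 + t *\<^sub>R w) {-e<..<e}"
    unfolding Cr_on_def
    by (intro allI impI, rule Ck_on_add)
      (simp_all add: Ck_on_bounded_linear bounded_linear_scaleR_left)
  then have "Cr_on r (\<lambda>t. q (u0 + t *\<^sub>R w)) {-e<..<e}"
    using Cr_on_compose[OF _ q(1) sub q(2)] by simp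
  then show "Cr_curve r M (q u0) (\<lambda>t. q (u0 + t *\<^sub>R w))"
    unfolding Cr_curve_def using e(1) sub q(3) by (auto intro!: exI[of _ e])
  have "((\<lambda>t. u0 + t *\<^sub>R w) has_vector_derivative w) (at 0)"
    by (auto intro!: derivative_eq_intros)
  moreover have "(q has_derivative frechet_derivative q (at u0)) (at (u0 + 0 *\<^sub>R w))"
    using Cr_on_has_derivative[OF assms(1) q(2) assms(3)] by simp
  ultimately show "((\<lambda>t. q (u0 + t *\<^sub>R w)) has_vector_derivative frechet_derivative q (at u0) w) (at 0)"
    by (rule vector_derivative_diff_chain_within[of _ _ 0 UNIV q, unfolded o_def, OF _ has_derivative_at_withinI])
qed

text \<open>A curve in \<open>M\<close> is \<open>q\<close> applied to its coordinate curve \<open>F \<circ> \<gamma>\<close>. Differentiating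
\<open>q \<circ> F \<circ> \<gamma> = \<gamma>\<close> shows that every tangent vector lies in the range of \<open>Dq\<close> and that \<open>Dq\<close>
undoes \<open>DF\<close> on it, hence that \<open>DF\<close> is injective on the tangent space.\<close>
lemma Cr_curve_lift:
  assumes "1 \<le> r" and q: "Cr_parametrization r M U q" "u0 \<in> U" "q u0 = x"
    and W: "x \<in> W" and F: "ambient_chart r M U q W F"
    and \<gamma>: "Cr_curve r M x \<gamma>"
  shows "F (\<gamma> 0) = u0"
    and "\<forall>\<^sub>F t in nhds 0. q (F (\<gamma> t)) = \<gamma> t"
    and "((\<lambda>t. F (\<gamma> t)) has_vector_derivative frechet_derivative F (at x) (velocity \<gamma>)) (at 0)"
    and "frechet_derivative q (at u0) (frechet_derivative F (at x) (velocity \<gamma>)) = velocity \<gamma>"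
proof -
  have \<gamma>0: "\<gamma> 0 = x" using \<gamma> by (simp add: Cr_curve_def)
  show F0: "F (\<gamma> 0) = u0" using ambient_chartD(5)[OF F q(2)] q(3) W \<gamma>0 by simp
  show ev: "\<forall>\<^sub>F t in nhds 0. q (F (\<gamma> t)) = \<gamma> t"
    using Cr_curve_eventually_in[OF \<gamma> ambient_chartD(1)[OF F] W]
    by eventually_elim (simp add: ambient_chartD(4)[OF F])
  have d\<gamma>: "(\<gamma> has_vector_derivative velocity \<gamma>) (at 0)"
    by (rule Cr_curve_has_vector_derivative[OF assms(1) \<gamma>])
  have dF: "(F has_derivative frechet_derivative F (at x)) (at (\<gamma> 0))"
    using Cr_on_has_derivative[OF assms(1) ambient_chartD(2)[OF F] W] \<gamma>0 by simp
  show da: "((\<lambda>t. F (\<gamma> t)) has_vector_derivative frechet_derivative F (at x) (velocity \<gamma>)) (at 0)"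
    using vector_derivative_diff_chain_within[OF d\<gamma> has_derivative_at_withinI[OF dF]] by (simp add: o_def)
  have dq: "(q has_derivative frechet_derivative q (at u0)) (at (F (\<gamma> 0)))"
    using Cr_on_has_derivative[OF assms(1) _ q(2), of q] q(1) F0 by (simp add: Cr_parametrization_def)
  have "((\<lambda>t. q (F (\<gamma> t))) has_vector_derivative
      frechet_derivative q (at u0) (frechet_derivative F (at x) (velocity \<gamma>))) (at 0)"
    using vector_derivative_diff_chain_within[OF da has_derivative_at_withinI[OF dq]] by (simp add: o_def)
  then have "(\<gamma> has_vector_derivative
      frechet_derivative q (at u0) (frechet_derivative F (at x) (velocity \<gamma>))) (at 0)"
    unfolding has_vector_derivative_def
    by (rule has_derivative_transform_eventually)
      (use ev eventually_nhds_x_imp_x[OF ev] in \<open>auto simp: eventually_at_filter elim: eventually_mono\<close>)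
  then show "frechet_derivative q (at u0) (frechet_derivative F (at x) (velocity \<gamma>)) = velocity \<gamma>"
    using vector_derivative_unique_at[OF _ d\<gamma>] by blast
qed

lemma chart_derivative_left_inverse:
  assumes "1 \<le> r" and q: "Cr_parametrization r M U q" "u0 \<in> U"
    and W: "q u0 \<in> W" and F: "ambient_chart r M U q W F"
  shows "frechet_derivative F (at (q u0)) (frechet_derivative q (at u0) w) = w"
proof -
  have U: "open U" "Cr_on r q U" using q(1) by (auto simp: Cr_parametrization_def)
  define V where "V = U \<inter> q -` W"
  have V: "open V" "u0 \<in> V"
    unfolding V_def using U ambient_chartD(1)[OF F] W q(2) Cr_on_imp_continuous_on
    by (auto intro: continuous_open_preimage)
  have "((\<lambda>u. F (q u)) has_derivative (\<lambda>w. frechet_derivative F (at (q u0)) (frechet_derivative q (at u0) w))) (at u0)"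
    using has_derivative_compose[OF Cr_on_has_derivative[OF assms(1) U(2) q(2)]
        Cr_on_has_derivative[OF assms(1) ambient_chartD(2)[OF F] W]] .
  then have "((\<lambda>u. u) has_derivative (\<lambda>w. frechet_derivative F (at (q u0)) (frechet_derivative q (at u0) w))) (at u0)"
    by (rule has_derivative_transform_within_open[OF _ V]) (use ambient_chartD(5)[OF F] in \<open>auto simp: V_def\<close>)
  then have "(\<lambda>w. frechet_derivative F (at (q u0)) (frechet_derivative q (at u0) w)) = (\<lambda>w. w)"
    using has_derivative_unique has_derivative_ident by blast
  then show ?thesis by (rule fun_cong)
qed

section \<open>Contact of curves\<close>
lemma Ck_on_imp_locally_lipschitz:
  fixes f :: "'a::euclidean_space \<Rightarrow> 'b::euclidean_space"
  assumes "open S" "x \<in> S" "Ck_on (Suc 0) f S"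
  obtains L d where "L \<ge> 0" "d > 0" "ball x d \<subseteq> S"
    and "\<And>y z. y \<in> ball x d \<Longrightarrow> z \<in> ball x d \<Longrightarrow> norm (f y - f z) \<le> L * norm (y - z)"
proof -
  let ?f' = "\<lambda>y. frechet_derivative f (at y)"
  let ?N = "\<lambda>y. \<Sum>b\<in>Basis. norm (?f' y b)"
  have der: "(f has_derivative ?f' y) (at y)" if "y \<in> S" for y
    using Ck_on_Suc_has_derivative[OF assms(3) that] .
  have "continuous_on S ?N"
    using assms(3) by (auto intro!: continuous_intros)
  then have "?N \<midarrow>x\<rightarrow> ?N x"
    using assms(1,2) by (simp add: continuous_on_eq_continuous_at isCont_def)
  then have "(?N \<longlongrightarrow> ?N x) (nhds x)"
    using tendsto_at_iff_tendsto_nhds[of ?N x] by blast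
  then have "\<forall>\<^sub>F y in nhds x. ?N y < ?N x + 1"
    by (rule order_tendstoD(2)) simp
  then have "\<forall>\<^sub>F y in nhds x. y \<in> S \<and> ?N y < ?N x + 1"
    using eventually_nhds_in_open[OF assms(1,2)] by eventually_elim auto
  then obtain d where d: "d > 0" "\<And>y. dist y x < d \<Longrightarrow> y \<in> S \<and> ?N y < ?N x + 1"
    unfolding eventually_nhds_metric by blast
  have "onorm (?f' y) \<le> ?N x + 1" if "y \<in> ball x d" for y
  proof (rule onorm_bound)
    have y: "y \<in> S" "?N y < ?N x + 1" using d(2)[of y] that by (auto simp: dist_commute)
    show "0 \<le> ?N x + 1" by (simp add: sum_nonneg add_nonneg_nonneg)
    fix v
    have "norm (?f' y v) \<le> (\<Sum>b\<in>Basis. \<bar>v \<bullet> b\<bar> * norm (?f' y b))"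
      by (subst has_derivative_euclidean_expand[OF der[OF y(1)]]) (auto intro!: order_trans[OF norm_sum])
    also have "\<dots> \<le> (\<Sum>b\<in>Basis. norm v * norm (?f' y b))"
      by (intro sum_mono mult_right_mono) (auto simp: Basis_le_norm)
    also have "\<dots> = ?N y * norm v" by (simp add: sum_distrib_left mult.commute[of _ "norm v"])
    also have "\<dots> \<le> (?N x + 1) * norm v" using y(2) by (intro mult_right_mono) auto
    finally show "norm (?f' y v) \<le> (?N x + 1) * norm v" .
  qed
  then have lip: "norm (f y - f z) \<le> (?N x + 1) * norm (y - z)" if "y \<in> ball x d" "z \<in> ball x d" for y z
    using that d(2)
    by (intro differentiable_bound[of "ball x d" f ?f'])
      (auto simp: dist_commute intro: has_derivative_at_withinI[OF der])
  have "0 \<le> ?N x + 1" by (simp add: sum_nonneg add_nonneg_nonneg)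
  moreover have "ball x d \<subseteq> S" using d(2) by (auto simp: dist_commute)
  ultimately show ?thesis using lip d(1) by (intro that)
qed

lemma curve_contact_order_le:
  assumes "(\<lambda>t. norm (\<gamma> t - \<gamma>' t)) \<notin> o[at 0](\<lambda>t. \<bar>t\<bar> ^ Suc n)"
  shows "curve_contact_order \<gamma> \<gamma>' \<le> enat n"
  unfolding curve_contact_order_def
proof (rule Sup_least)
  fix k assume "k \<in> {enat l | l. (\<lambda>t. norm (\<gamma> t - \<gamma>' t)) \<in> o[at 0](\<lambda>t. \<bar>t\<bar> ^ l)}"
  then obtain l where l: "k = enat l" "(\<lambda>t. norm (\<gamma> t - \<gamma>' t)) \<in> o[at 0](\<lambda>t. \<bar>t\<bar> ^ l)"
    by blast
  have "\<not> Suc n \<le> l"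
  proof
    assume "Suc n \<le> l"
    from landau_o.small_big_trans[OF l(2) abs_power_bigo[OF this]] show False
      using assms by contradiction
  qed
  then show "k \<le> enat n" using l(1) by simp
qed

text \<open>The direction \<open>v = Dq(u0) w\<close> comes from a \<open>w\<close> along which \<open>h = \<rho> \<circ> q - q\<close> is not
\<open>o(|t| ^ Suc n)\<close>. Here \<open>\<rho> \<circ> q\<close> plays the part of a parametrization of \<open>M'\<close>, adapted to \<open>q\<close>, so that
\<open>h\<close> cannot be smaller than the order of tangency permits. A pair of curves in direction \<open>v\<close> need not
come from the same parameter curve; the Lipschitz estimate for \<open>\<rho>\<close> bounds the error made by
replacing \<open>\<gamma>'\<close> with \<open>\<rho> \<circ> \<gamma>\<close>.\<close>
lemma contact_le_in_some_direction:
  fixes U U' :: "(real ^ 'p) set"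
  assumes r: "enat (Suc n) \<le> r"
    and q: "Cr_parametrization r M U q" "u0 \<in> U" "q u0 = x"
    and q': "Cr_parametrization r M' U' q'" "u0' \<in> U'" "q' u0' = x"
    and T: "tangent_space r M x = tangent_space r M' x"
    and no: "\<not> tangency_at_least TYPE(real ^ 'p) r M M' x (Suc n)"
  obtains v where "v \<in> tangent_space r M x" "v \<noteq> 0"
    and "\<And>\<gamma> \<gamma>'. (\<gamma>, \<gamma>') \<in> curve_pairs r M M' x v \<Longrightarrow> curve_contact_order \<gamma> \<gamma>' \<le> enat n"
proof -
  have r1: "1 \<le> r"
    using r by (metis One_nat_def enat_ord_simps(1) le_add1 one_enat_def order_trans plus_1_eq_Suc)
  have U: "open U" "Cr_on r q U" and U': "open U'" "Cr_on r q' U'"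
    using q(1) q'(1) by (auto simp: Cr_parametrization_def)
  obtain W F where xW: "x \<in> W" and F: "ambient_chart r M U q W F"
    using Cr_parametrization_ambient_chart[OF q(1,2)] q(3) by blast
  obtain W' F' where xW': "x \<in> W'" and F': "ambient_chart r M' U' q' W' F'"
    using Cr_parametrization_ambient_chart[OF q'(1,2)] q'(3) by blast
  note W' = ambient_chartD(1-3)[OF F']
  define \<rho> where "\<rho> y = q' (F' y)" for y
  have \<rho>: "Cr_on r \<rho> W'"
    unfolding \<rho>_def using Cr_on_compose[OF W'(1) U'(1) W'(3) U'(2) W'(2)] .
  have \<rho>_id: "\<rho> y = y" if "y \<in> W'" "y \<in> M'" for y
    unfolding \<rho>_def using ambient_chartD(4)[OF F' that] .
  define \<psi> where "\<psi> u = F' (q u)" for u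
  define S where "S = U \<inter> q -` W'"
  have S: "open S" "u0 \<in> S" "S \<subseteq> U" "q ` S \<subseteq> W'"
    unfolding S_def using U W'(1) q(2,3) xW' Cr_on_imp_continuous_on
    by (auto intro: continuous_open_preimage)
  have qS: "Cr_on r q S" using Cr_on_restrict[OF U(2) S(3)] .
  have \<psi>: "Cr_on r \<psi> S"
    unfolding \<psi>_def using Cr_on_compose[OF S(1) W'(1) S(4) W'(2) qS] .
  let ?Dq = "frechet_derivative q (at u0)" and ?DF = "frechet_derivative F (at x)"
  let ?DF' = "frechet_derivative F' (at x)"
  have Dq_tangent: "?Dq w \<in> tangent_space r M x" for w
  proof -
    note line = parametrization_line_curve[OF r1 q(1,2), of w]
    show ?thesis
      using line(1) q(3) vector_derivative_at[OF line(2)] unfolding tangent_space_def by force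
  qed
  have DFq: "?DF (?Dq w) = w" for w
    using chart_derivative_left_inverse[OF r1 q(1,2) _ F] q(3) xW by simp
  \<comment> \<open>The equality of the tangent spaces enters here: \<open>Dq w\<close> is tangent to \<open>M'\<close> as well, where
    \<open>Dq'\<close> recovers it from its image under \<open>DF'\<close>.\<close>
  have "?Dq w = 0" if "?DF' (?Dq w) = 0" for w
  proof -
    obtain \<gamma> where \<gamma>: "Cr_curve r M' x \<gamma>" "velocity \<gamma> = ?Dq w"
      using Dq_tangent[of w] T unfolding tangent_space_def by force
    have "frechet_derivative q' (at u0') (?DF' (?Dq w)) = ?Dq w"
      using Cr_curve_lift(4)[OF r1 q' xW' F' \<gamma>(1)] \<gamma>(2) by simp
    moreover have "linear (frechet_derivative q' (at u0'))"
      using Cr_on_has_derivative[OF r1 U'(2) q'(2)] has_derivative_linear by blast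
    ultimately show ?thesis using that linear_0 by metis
  qed
  moreover have "linear ?DF"
    using Cr_on_has_derivative[OF r1 ambient_chartD(2)[OF F] xW] has_derivative_linear by blast
  ultimately have ker: "w = 0" if "?DF' (?Dq w) = 0" for w
    using that DFq[of w] linear_0 by metis
  have d\<psi>: "(\<psi> has_derivative (\<lambda>w. ?DF' (?Dq w))) (at u0)"
    unfolding \<psi>_def
    by (rule has_derivative_compose[OF Cr_on_has_derivative[OF r1 U(2) q(2)]])
      (use Cr_on_has_derivative[OF r1 W'(2) xW'] q(3) in simp)
  have "inj (frechet_derivative \<psi> (at u0))"
    using ker has_derivative_linear[OF d\<psi>] linear_injective_0
    unfolding frechet_derivative_at[OF d\<psi>, symmetric] by blast
  then obtain A B g where AB: "open A" "A \<subseteq> S" "u0 \<in> A" "open B" "homeomorphism A B \<psi> g" "Cr_on r g B"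
    using Cr_on_inverse_function[OF r1 S(1) \<psi> S(2)] by blast
  have "B = \<psi> ` A" using AB(5) by (simp add: homeomorphism_def)
  then have "B \<subseteq> U'" using AB(2) S(4) W'(3) by (auto simp: \<psi>_def)
  then have qA': "Cr_parametrization r M' A (\<lambda>u. q' (\<psi> u))"
    using Cr_parametrization_reparametrize[OF q'(1) AB(1,4) _ AB(5) Cr_on_restrict[OF \<psi> AB(2)] AB(6)] by blast
  have qA: "Cr_parametrization r M A q"
    using Cr_parametrization_restrict[OF q(1) AB(1)] AB(2) S(3) by blast
  define h where "h u = \<rho> (q u) - q u" for u
  have "\<psi> u0 = u0'"
    using ambient_chartD(5)[OF F' q'(2)] q'(3) q(3) xW' by (simp add: \<psi>_def)
  then have "q' (\<psi> u0) = x" using q'(3) by simp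
  then have h0: "h u0 = 0" using q(3) by (simp add: h_def \<rho>_def \<psi>_def)
  have not_small: "(\<lambda>u. norm (h u)) \<notin> o[at u0](\<lambda>u. norm (u - u0) ^ Suc n)"
  proof
    assume "(\<lambda>u. norm (h u)) \<in> o[at u0](\<lambda>u. norm (u - u0) ^ Suc n)"
    then have "(\<lambda>u. norm (q' (\<psi> u) - q u)) \<in> o[at u0 within A](\<lambda>u. norm (u - u0) ^ Suc n)"
      unfolding at_within_open[OF AB(3,1)] by (simp only: h_def \<rho>_def \<psi>_def)
    then show False
      using no AB(3) qA qA' q(3) \<open>q' (\<psi> u0) = x\<close> unfolding tangency_at_least_def by blast
  qed
  have "Ck_on (Suc n) (\<lambda>u. \<rho> (q u)) S" "Ck_on (Suc n) q S"
    using Cr_on_compose[OF S(1) W'(1) S(4) \<rho> qS] qS r unfolding Cr_on_def by blast+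
  then have Ckh: "Ck_on (Suc n) h S"
    unfolding h_def by (rule Ck_on_diff[OF S(1)])
  from not_smallo_imp_curves_not_smallo[OF S(1,2) Ckh not_small]
  obtain w where w: "\<And>\<beta> c. \<beta> 0 = u0 \<Longrightarrow> c \<noteq> 0 \<Longrightarrow> (\<beta> has_vector_derivative c *\<^sub>R w) (at 0) \<Longrightarrow>
    (\<lambda>t. norm (h (\<beta> t))) \<notin> o[at 0](\<lambda>t::real. \<bar>t\<bar> ^ Suc n)" by metis
  \<comment> \<open>Otherwise the constant curve would be admissible, and \<open>h\<close> vanishes on it.\<close>
  have "w \<noteq> 0"
    using w[of "\<lambda>_. u0" 1] h0 by auto
  then have "?Dq w \<noteq> 0"
    using DFq[of w] linear_0[OF \<open>linear ?DF\<close>] by auto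
  have "Ck_on (Suc 0) \<rho> W'"
    using \<rho> r1 unfolding Cr_on_def one_enat_def by (simp del: Ck_on.simps)
  then obtain L d where L: "L \<ge> 0" "d > 0"
    and lip: "\<And>y z. y \<in> ball x d \<Longrightarrow> z \<in> ball x d \<Longrightarrow> norm (\<rho> y - \<rho> z) \<le> L * norm (y - z)"
    using Ck_on_imp_locally_lipschitz[OF W'(1) xW'] by metis
  have "curve_contact_order \<gamma> \<gamma>' \<le> enat n" if pair: "(\<gamma>, \<gamma>') \<in> curve_pairs r M M' x (?Dq w)" for \<gamma> \<gamma>'
  proof (rule curve_contact_order_le, rule notI)
    assume small: "(\<lambda>t. norm (\<gamma> t - \<gamma>' t)) \<in> o[at 0](\<lambda>t. \<bar>t\<bar> ^ Suc n)"
    from pair have \<gamma>: "Cr_curve r M x \<gamma>" and \<gamma>': "Cr_curve r M' x \<gamma>'"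
      and "velocity \<gamma> \<noteq> 0" "parallel_to (velocity \<gamma>) (?Dq w)"
      by (auto simp: curve_pairs_def)
    then obtain c where c: "velocity \<gamma> = c *\<^sub>R ?Dq w" "c \<noteq> 0"
      by (auto simp: parallel_to_def)
    note lift = Cr_curve_lift[OF r1 q xW F \<gamma>]
    have "?DF (velocity \<gamma>) = c *\<^sub>R w"
      using c(1) DFq linear_cmul[OF \<open>linear ?DF\<close>] by simp
    with lift(3) have "((\<lambda>t. F (\<gamma> t)) has_vector_derivative c *\<^sub>R w) (at 0)" by simp
    with w[of "\<lambda>t. F (\<gamma> t)"] lift(1) c(2)
    have "(\<lambda>t. norm (h (F (\<gamma> t)))) \<notin> o[at 0](\<lambda>t. \<bar>t\<bar> ^ Suc n)" by blast
    moreover have "(\<lambda>t. norm (h (F (\<gamma> t)))) \<in> o[at 0](\<lambda>t. \<bar>t\<bar> ^ Suc n)"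
    proof (rule smallo_mono_norm)
      show "(\<lambda>t. (L + 1) * norm (\<gamma> t - \<gamma>' t)) \<in> o[at 0](\<lambda>t. \<bar>t\<bar> ^ Suc n)"
        using small L(1) by (subst landau_o.small.cmult_in_iff) auto
      have ball: "open (ball x d)" "x \<in> ball x d" using L(2) by auto
      have "\<forall>\<^sub>F t in nhds 0. norm (h (F (\<gamma> t))) \<le> (L + 1) * norm (\<gamma> t - \<gamma>' t)"
        using lift(2) Cr_curve_eventually_in[OF \<gamma> ball] Cr_curve_eventually_in[OF \<gamma>' ball]
          Cr_curve_eventually_in[OF \<gamma>' W'(1) xW']
      proof eventually_elim
        case (elim t)
        have "h (F (\<gamma> t)) = (\<rho> (\<gamma> t) - \<rho> (\<gamma>' t)) - (\<gamma> t - \<gamma>' t)"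
          using elim \<rho>_id by (simp add: h_def)
        then have "norm (h (F (\<gamma> t))) \<le> norm (\<rho> (\<gamma> t) - \<rho> (\<gamma>' t)) + norm (\<gamma> t - \<gamma>' t)"
          by (simp only: norm_triangle_ineq4)
        also have "norm (\<rho> (\<gamma> t) - \<rho> (\<gamma>' t)) \<le> L * norm (\<gamma> t - \<gamma>' t)"
          using elim by (intro lip) auto
        finally show ?case by (simp add: algebra_simps)
      qed
      then show "\<forall>\<^sub>F t in at 0. norm (h (F (\<gamma> t))) \<le> (L + 1) * norm (\<gamma> t - \<gamma>' t)"
        by (auto simp: eventually_at_filter elim: eventually_mono)
    qed
    ultimately show False by contradiction
  qed
  with Dq_tangent[of w] \<open>?Dq w \<noteq> 0\<close> show ?thesis by (rule that)
qed

lemma has_vector_derivative_zero_if_smallo: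
  fixes f :: "real \<Rightarrow> 'a::real_normed_vector"
  assumes "f 0 = 0" "(\<lambda>t. norm (f t)) \<in> o[at 0](\<lambda>t. \<bar>t\<bar>)"
  shows "(f has_vector_derivative 0) (at 0)"
proof -
  have "((\<lambda>t. norm (f t) / \<bar>t\<bar>) \<longlongrightarrow> 0) (at 0)"
    using smalloD_tendsto[OF assms(2)] .
  then have "((\<lambda>t. norm (f t /\<^sub>R \<bar>t\<bar>)) \<longlongrightarrow> 0) (at 0)"
    by (simp add: divide_inverse mult.commute)
  then have "((\<lambda>t. f t /\<^sub>R \<bar>t\<bar>) \<longlongrightarrow> 0) (at 0)"
    by (rule tendsto_norm_zero_cancel)
  then show ?thesis
    using assms(1) by (simp add: has_vector_derivative_def has_derivative_def)
qed

text \<open>The two parametrizations are evaluated on one line in the parameter space. The hypothesis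
\<open>1 \<le> n\<close> is what makes the velocities of the two image curves equal.\<close>
lemma contact_ge_in_every_direction:
  fixes M M' :: "'a::euclidean_space set"
  assumes r: "1 \<le> r" and n: "1 \<le> n"
    and tan: "tangency_at_least TYPE('p::euclidean_space) r M M' x n"
    and v: "v \<in> tangent_space r M x" "v \<noteq> 0"
  obtains \<gamma> \<gamma>' where "(\<gamma>, \<gamma>') \<in> curve_pairs r M M' x v" "enat n \<le> curve_contact_order \<gamma> \<gamma>'"
proof -
  from tan obtain u0 :: 'p and U q q' where u0: "u0 \<in> U"
    and q: "Cr_parametrization r M U q" "q u0 = x"
    and q': "Cr_parametrization r M' U q'" "q' u0 = x"
    and small: "(\<lambda>u. norm (q' u - q u)) \<in> o[at u0 within U](\<lambda>u. norm (u - u0) ^ n)"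
    unfolding tangency_at_least_def by blast
  obtain W F where xW: "x \<in> W" and F: "ambient_chart r M U q W F"
    using Cr_parametrization_ambient_chart[OF q(1) u0] q(2) by blast
  obtain \<alpha> where \<alpha>: "Cr_curve r M x \<alpha>" "velocity \<alpha> = v"
    using v(1) by (auto simp: tangent_space_def)
  define w where "w = frechet_derivative F (at x) v"
  have w: "frechet_derivative q (at u0) w = v"
    using Cr_curve_lift(4)[OF r q(1) u0 q(2) xW F \<alpha>(1)] \<alpha>(2) by (simp add: w_def)
  have U: "open U" "Cr_on r q U" using q(1) by (auto simp: Cr_parametrization_def)
  have "linear (frechet_derivative q (at u0))"
    using Cr_on_has_derivative[OF r U(2) u0] has_derivative_linear by blast
  then have "w \<noteq> 0" using w v(2) linear_0 by blast
  define \<gamma> \<gamma>' where "\<gamma> t = q (u0 + t *\<^sub>R w)" and "\<gamma>' t = q' (u0 + t *\<^sub>R w)" for t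
  have \<gamma>: "Cr_curve r M x \<gamma>" "(\<gamma> has_vector_derivative v) (at 0)"
    using parametrization_line_curve[OF r q(1) u0, of w] w q(2) unfolding \<gamma>_def by auto
  have \<gamma>': "Cr_curve r M' x \<gamma>'"
      "(\<gamma>' has_vector_derivative frechet_derivative q' (at u0) w) (at 0)"
    using parametrization_line_curve[OF r q'(1) u0, of w] q'(2) unfolding \<gamma>'_def by auto
  have "filterlim (\<lambda>t. u0 + t *\<^sub>R w) (at u0) (at 0)"
  proof (rule filterlim_atI)
    have "((\<lambda>t. u0 + t *\<^sub>R w) \<longlongrightarrow> u0 + 0 *\<^sub>R w) (at 0)" by (intro tendsto_intros)
    then show "((\<lambda>t. u0 + t *\<^sub>R w) \<longlongrightarrow> u0) (at 0)" by simp
    show "\<forall>\<^sub>F t in at 0. u0 + t *\<^sub>R w \<noteq> u0"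
      using \<open>w \<noteq> 0\<close> by (simp add: eventually_at_filter)
  qed
  then have "(\<lambda>t. norm (\<gamma>' t - \<gamma> t)) \<in> o[at 0](\<lambda>t. norm (u0 + t *\<^sub>R w - u0) ^ n)"
    using landau_o.small.compose[OF small[unfolded at_within_open[OF u0 U(1)]]]
    unfolding \<gamma>_def \<gamma>'_def by blast
  then have "(\<lambda>t. norm (\<gamma>' t - \<gamma> t)) \<in> o[at 0](\<lambda>t. norm w ^ n * \<bar>t\<bar> ^ n)"
    by (simp add: power_mult_distrib mult.commute)
  then have d: "(\<lambda>t. norm (\<gamma>' t - \<gamma> t)) \<in> o[at 0](\<lambda>t. \<bar>t\<bar> ^ n)"
    using \<open>w \<noteq> 0\<close> by (subst (asm) landau_o.small.cmult) auto
  then have "(\<lambda>t. norm (\<gamma>' t - \<gamma> t)) \<in> o[at 0](\<lambda>t. \<bar>t\<bar>)"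
    using landau_o.small_big_trans[OF d abs_power_bigo[OF n]] by simp
  then have "((\<lambda>t. \<gamma>' t - \<gamma> t) has_vector_derivative 0) (at 0)"
    using q(2) q'(2) by (intro has_vector_derivative_zero_if_smallo) (simp_all add: \<gamma>_def \<gamma>'_def)
  then have "frechet_derivative q' (at u0) w - v = 0"
    using vector_derivative_unique_at has_vector_derivative_diff[OF \<gamma>'(2) \<gamma>(2)] by blast
  then have "velocity \<gamma> = v" "velocity \<gamma>' = v"
    using vector_derivative_at[OF \<gamma>(2)] vector_derivative_at[OF \<gamma>'(2)] by simp_all
  then have "(\<gamma>, \<gamma>') \<in> curve_pairs r M M' x v"
    using \<gamma>(1) \<gamma>'(1) v(2) by (auto simp: curve_pairs_def parallel_to_def intro: exI[of _ 1])
  moreover have "(\<lambda>t. norm (\<gamma> t - \<gamma>' t)) \<in> o[at 0](\<lambda>t. \<bar>t\<bar> ^ n)"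
    using d by (simp add: norm_minus_commute)
  then have "enat n \<le> curve_contact_order \<gamma> \<gamma>'"
    unfolding curve_contact_order_def by (intro Sup_upper) blast
  ultimately show ?thesis by (rule that)
qed

section \<open>The order of tangency as a minimum over directions\<close>

text \<open>The supremum of a set of extended naturals is attained when it is finite and non-zero; the value
zero is excluded because it is also the supremum of the empty set.\<close>
lemma Sup_enat_attained:
  fixes A :: "enat set"
  assumes "Sup A = enat n" "n \<noteq> 0"
  shows "enat n \<in> A"
proof -
  have "A \<noteq> {}" "finite A"
    using assms by (auto simp: Sup_enat_def zero_enat_def split: if_splits)
  then show ?thesis using assms(1) Max_in[of A] by (simp add: Sup_enat_def)
qed

theorem theorem1:
  fixes M M' :: "(real ^ 'm) set" and x0 :: "real ^ 'm" and r s :: enat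
  assumes "1 \<le> r"
    and "Cr_manifold TYPE(real ^ 'p) r M"
    and "Cr_manifold TYPE(real ^ 'p) r M'"
    and "x0 \<in> M \<inter> M'"
    and "tangent_space r M x0 = tangent_space r M' x0"
    and "s = Sup {enat k | k. enat k \<le> r \<and> tangency_at_least TYPE(real ^ 'p) r M M' x0 k}"
    and "s < r"
  shows "(INF v \<in> tangent_space r M x0 - {0}.
            SUP (g, g') \<in> curve_pairs r M M' x0 v. curve_contact_order g g') = s"
proof -
  let ?K = "{enat k | k. enat k \<le> r \<and> tangency_at_least TYPE(real ^ 'p) r M M' x0 k}"
  obtain n where n: "s = enat n"
    using assms(7) by (cases s) auto
  obtain U :: "(real ^ 'p) set" and q where "Cr_parametrization r M U q" "x0 \<in> q ` U"
    using assms(2,4) unfolding Cr_manifold_def by blast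
  then obtain u0 where q: "Cr_parametrization r M U q" "u0 \<in> U" "q u0 = x0" by blast
  obtain U' :: "(real ^ 'p) set" and q' where "Cr_parametrization r M' U' q'" "x0 \<in> q' ` U'"
    using assms(3,4) unfolding Cr_manifold_def by blast
  then obtain u0' where q': "Cr_parametrization r M' U' q'" "u0' \<in> U'" "q' u0' = x0" by blast
  have Sn: "enat (Suc n) \<le> r"
    using assms(7) n by (simp add: Suc_ile_eq)
  have "\<not> tangency_at_least TYPE(real ^ 'p) r M M' x0 (Suc n)"
  proof
    assume "tangency_at_least TYPE(real ^ 'p) r M M' x0 (Suc n)"
    then have "enat (Suc n) \<le> s" unfolding assms(6) using Sn by (intro Sup_upper) blast
    then show False using n by simp
  qed
  then obtain v where v: "v \<in> tangent_space r M x0" "v \<noteq> 0"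
    and le: "\<And>\<gamma> \<gamma>'. (\<gamma>, \<gamma>') \<in> curve_pairs r M M' x0 v \<Longrightarrow> curve_contact_order \<gamma> \<gamma>' \<le> enat n"
    using contact_le_in_some_direction[OF Sn q q' assms(5)] by blast
  show ?thesis
  proof (rule antisym)
    have "(SUP (g, g') \<in> curve_pairs r M M' x0 v. curve_contact_order g g') \<le> s"
      unfolding n by (rule SUP_least) (use le in auto)
    then show "(INF v \<in> tangent_space r M x0 - {0}.
        SUP (g, g') \<in> curve_pairs r M M' x0 v. curve_contact_order g g') \<le> s"
      using v by (intro INF_lower2[of v]) auto
    show "s \<le> (INF v \<in> tangent_space r M x0 - {0}.
        SUP (g, g') \<in> curve_pairs r M M' x0 v. curve_contact_order g g')"
    proof (rule INF_greatest)
      fix v assume v: "v \<in> tangent_space r M x0 - {0}"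
      show "s \<le> (SUP (g, g') \<in> curve_pairs r M M' x0 v. curve_contact_order g g')"
      proof (cases "n = 0")
        case True
        then show ?thesis using n by (simp flip: zero_enat_def)
      next
        case False
        have "enat n \<in> ?K"
          by (rule Sup_enat_attained[OF _ False]) (use assms(6) n in argo)
        then have "tangency_at_least TYPE(real ^ 'p) r M M' x0 n" by simp
        moreover have "1 \<le> n" "v \<in> tangent_space r M x0" "v \<noteq> 0" using False v by auto
        ultimately obtain \<gamma> \<gamma>'
          where "(\<gamma>, \<gamma>') \<in> curve_pairs r M M' x0 v" "enat n \<le> curve_contact_order \<gamma> \<gamma>'"
          using contact_ge_in_every_direction[OF assms(1)] by blast
        then show ?thesis
          unfolding n by (intro SUP_upper2[of "(\<gamma>, \<gamma>')"]) auto
      qed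
    qed
  qed
qed

end
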